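(* Let $n\ge 2$ and let $\psi:\mathbb{R}_{>0}\to\mathbb{R}_{>0}$ be monotonic with $\psi(h)\to 0$ as $h\to\infty$. Then the Lebesgue measure of $W_n(\psi)$ satisfies \[ |W_n(\psi)|=\begin{cases}0, & \text{if } \sum_{h=1}^\infty h^{n-2}\psi(h)<\infty,\\[1ex] 1, & \text{if } \sum_{h=1}^\infty h^{n-2}\psi(h)=\infty.\end{cases} \]
   Context: $\mathbb{Z}_{\ge0}$ denotes the set of non-negative integers. For $\mathbf{a}=(a_1,\dots,a_n)\in\mathbb{Z}^n$ the height is $h_{\mathbf{a}}=\max(|a_1|,\dots,|a_n|)$, and $\mathbf{a}^2:=(a_1^2,\dots,a_n^2)$. For $\psi:\mathbb{R}_{>0}\to\mathbb{R}_{>0}$ with $\psi(h)\to0$, define \[ W_n(\psi)=\{\mathbf{x}\in[0,1]^n:\ |\mathbf{a}^2\cdot\mathbf{x}-b^2|<\psi(h_{\mathbf{a}})\ \text{for infinitely many } (\mathbf{a},b)\in\mathbb{Z}_{\ge0}^{n+1} \text{ with } \mathbf{a}\neq\mathbf{0}\}, \] where $\cdot$ is the standard inner product. $|A|$ denotes Lebesgue measure. *)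

theory Defs
  imports "HOL-Analysis.Analysis"
begin

definition height :: "('n::finite \<Rightarrow> nat) \<Rightarrow> nat" where
  "height a = Max (range a)"

definition W :: "(real \<Rightarrow> real) \<Rightarrow> (real ^ 'n::finite) set" where
  "W \<psi> = {x \<in> cbox 0 1.
      infinite {(a :: 'n \<Rightarrow> nat, b :: nat). a \<noteq> (\<lambda>_. 0) \<and>
        \<bar>(\<Sum>i\<in>UNIV. real (a i) ^ 2 * x $ i) - real b ^ 2\<bar> < \<psi> (real (height a))}}"

end

theory Submission
  imports Defs "HOL-Real_Asymp.Real_Asymp"
begin

text \<open>
  The vector \<open>a\<close> contributes the set of points at which \<open>a\<^sup>2 \<cdot> x\<close> is within \<open>\<psi>\<close> of a square. As squares near
  \<open>h\<^sup>2\<close> are \<open>2 h\<close> apart, this set occupies a proportion of order \<open>\<psi>(h) / h\<close> of every fixed cube, and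
  the convergence case is the Borel--Cantelli lemma.

  For divergence, consider vectors with all coordinates in \<open>(N, 16 N]\<close>, \<open>N = 16\<^sup>k\<close>, and with two fixed
  coordinates coprime; these are a positive proportion of all vectors. Two such vectors at scales
  \<open>N \<le> N'\<close> have sets that are independent up to a constant, except for an error of relative size
  \<open>N / (r m)\<close>, where \<open>r\<close> is the side of the cube and \<open>m\<close> a non-zero 2 by 2 minor of the pair. A pair
  \<open>(u', v')\<close> is determined by its determinant with \<open>(u, v)\<close> and by the quotient of \<open>u'\<close> by \<open>u\<close>, so these
  errors add up to \<open>O(N' log N')\<close> instead of \<open>N'\<^sup>2\<close> and are negligible. The second moment method
  shows that the limsup set fills a proportion at least \<open>\<kappa>\<close> of every cube in \<open>[\<eta>\<^sup>2, 1]\<^sup>n\<close>, with \<open>\<kappa>\<close>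
  independent of the cube, and a covering argument turns this into full measure.
\<close>

text \<open>The obstacle is correlation: the sets of two nearly parallel vectors overlap far more
  than independent sets would. Two facts control this. Moving in a direction that leaves a^2 . x
  unchanged alters a'^2 . x at a rate proportional to a_i^2 a'_j^2 - a_j^2 a'_i^2, which is the
  linear minor times a_i a'_j + a_j a'_i. All entries are positive, so the second factor has its
  full size and only the minor can be small. And coprimality of one fixed pair of coordinates
  guarantees a non-zero minor for distinct vectors, so that what remains is a count of 2 by 2
  determinants. The lower bound \<eta>^2 on the coordinates keeps a^2 . x above (\<eta> N)^2, where
  consecutive squares are at least of order \<eta> N apart; for smaller values they would be denser.
  It makes \<kappa> depend on \<eta>, which is harmless: \<eta> tends to 0 only after full measure
  has been reached on [\<eta>^2, 1]^n. On each block \<psi> is replaced by its value at the largest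
  possible height. The block then has one tolerance, and divergence survives by condensation along
  powers of 16.\<close>

subsection \<open>Slices along lines\<close>

text \<open>Averaging over translates along an arbitrary direction \<^term>\<open>w\<close> plays the role of Fubini's theorem in
  coordinates adapted to \<^term>\<open>w\<close>, without any change of variables.\<close>

lemma nn_integral_line_slices:
  fixes S :: "'a::euclidean_space set"
  assumes S[measurable]: "S \<in> sets borel" and T: "T \<ge> 0"
  shows "(\<integral>\<^sup>+x. emeasure lborel {t\<in>{0..T}. x + t *\<^sub>R w \<in> S} \<partial>lborel) = ennreal T * emeasure lborel S"
proof -
  have m: "(\<lambda>(x::'a, t::real). indicator {0..T} t * indicator S (x + t *\<^sub>R w) :: ennreal)
      \<in> borel_measurable (lborel \<Otimes>\<^sub>M lborel)"
    by measurable
  have "(\<integral>\<^sup>+x. emeasure lborel {t\<in>{0..T}. x + t *\<^sub>R w \<in> S} \<partial>lborel)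
      = (\<integral>\<^sup>+x. (\<integral>\<^sup>+t. indicator {0..T} t * indicator S (x + t *\<^sub>R w) \<partial>lborel) \<partial>lborel)"
  proof (rule nn_integral_cong)
    fix x :: 'a
    have "{t\<in>{0..T}. x + t *\<^sub>R w \<in> S} \<in> sets lborel" by measurable
    then show "emeasure lborel {t\<in>{0..T}. x + t *\<^sub>R w \<in> S}
        = (\<integral>\<^sup>+t. indicator {0..T} t * indicator S (x + t *\<^sub>R w) \<partial>lborel)"
      by (subst nn_integral_indicator[symmetric])
        (auto intro!: nn_integral_cong simp: indicator_def simp del: nn_integral_indicator)
  qed
  also have "\<dots> = (\<integral>\<^sup>+t. (\<integral>\<^sup>+x. indicator {0..T} t * indicator S (x + t *\<^sub>R w) \<partial>lborel) \<partial>lborel)"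
    using lborel_pair.Fubini'[OF m] by simp
  also have "\<dots> = (\<integral>\<^sup>+t. indicator {0..T} t * emeasure lborel S \<partial>lborel)"
  proof (rule nn_integral_cong)
    fix t :: real
    have "emeasure lborel S = emeasure (distr lborel borel ((+) (t *\<^sub>R w))) S"
      by (simp add: lborel_distr_plus)
    also have "\<dots> = (\<integral>\<^sup>+x. indicator S x \<partial>distr lborel borel ((+) (t *\<^sub>R w)))"
      by simp
    also have "\<dots> = (\<integral>\<^sup>+x. indicator S (x + t *\<^sub>R w) \<partial>lborel)"
      by (subst nn_integral_distr) (auto simp: add.commute)
    finally show "(\<integral>\<^sup>+x. indicator {0..T} t * indicator S (x + t *\<^sub>R w) \<partial>lborel)
        = indicator {0..T} t * emeasure lborel S"
      by (simp add: nn_integral_cmult)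
  qed
  also have "\<dots> = ennreal T * emeasure lborel S"
    using T by (simp add: nn_integral_multc)
  finally show ?thesis .
qed

text \<open>Slices based outside \<open>Q\<close> are empty, so the average of the slices is at most
  \<open>K\<close> times the measure of \<open>Q\<close>. In the applications \<open>Q\<close> is an
  enlarged cube, possibly cut by a condition that is invariant along \<open>w\<close>.\<close>

lemma measure_le_of_line_slices:
  fixes S Q :: "'a::euclidean_space set"
  assumes S: "S \<in> sets borel" and Q: "Q \<in> sets borel" "emeasure lborel Q < \<infinity>"
    and T: "T > 0" and K: "K \<ge> 0"
    and sub: "\<And>x t. 0 \<le> t \<Longrightarrow> t \<le> T \<Longrightarrow> x + t *\<^sub>R w \<in> S \<Longrightarrow> x \<in> Q"
    and bd: "\<And>x. measure lborel {t\<in>{0..T}. x + t *\<^sub>R w \<in> S} \<le> K"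
  shows "emeasure lborel S < \<infinity>" "measure lborel S \<le> K / T * measure lborel Q"
proof -
  have fin: "emeasure lborel {t\<in>{0..T}. x + t *\<^sub>R w \<in> S} < \<infinity>" for x
    by (rule le_less_trans[OF emeasure_mono[of _ "{0..T}"]]) (use T in auto)
  have "ennreal T * emeasure lborel S
      = (\<integral>\<^sup>+x. emeasure lborel {t\<in>{0..T}. x + t *\<^sub>R w \<in> S} \<partial>lborel)"
    using nn_integral_line_slices[OF S, of T w] T by simp
  also have "\<dots> \<le> (\<integral>\<^sup>+x. ennreal K * indicator Q x \<partial>lborel)"
  proof (rule nn_integral_mono)
    fix x
    show "emeasure lborel {t\<in>{0..T}. x + t *\<^sub>R w \<in> S} \<le> ennreal K * indicator Q x"
    proof (cases "x \<in> Q")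
      case True
      have "emeasure lborel {t\<in>{0..T}. x + t *\<^sub>R w \<in> S}
          = ennreal (measure lborel {t\<in>{0..T}. x + t *\<^sub>R w \<in> S})"
        using fin[of x] by (intro emeasure_eq_ennreal_measure) auto
      with True bd[of x] show ?thesis by (simp add: ennreal_leI)
    next
      case False
      then have "{t\<in>{0..T}. x + t *\<^sub>R w \<in> S} = {}" using sub by auto
      then show ?thesis by (simp del: Collect_empty_eq)
    qed
  qed
  also have "\<dots> = ennreal K * emeasure lborel Q"
    using Q by (simp add: nn_integral_cmult)
  also have "\<dots> = ennreal (K * measure lborel Q)"
    using Q K by (simp add: emeasure_eq_ennreal_measure ennreal_mult)
  finally have *: "ennreal T * emeasure lborel S \<le> ennreal (K * measure lborel Q)" .
  \<comment> \<open>\<open>measure\<close> is 0 on sets of infinite measure, so finiteness has to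
    precede the passage to real numbers.\<close>
  show fS: "emeasure lborel S < \<infinity>"
  proof (rule ccontr)
    assume "\<not> emeasure lborel S < \<infinity>"
    then have "emeasure lborel S = top"
      by (simp only: less_top[symmetric] infinity_ennreal_def not_not)
    with * T show False by (simp add: ennreal_mult_top top_unique)
  qed
  then have "ennreal (T * measure lborel S) \<le> ennreal (K * measure lborel Q)"
    using * T by (simp add: emeasure_eq_ennreal_measure ennreal_mult)
  then have "T * measure lborel S \<le> K * measure lborel Q"
    using K by (subst (asm) ennreal_le_iff) auto
  then show "measure lborel S \<le> K / T * measure lborel Q"
    using T by (simp add: field_simps)
qed

text \<open>Counterpart of the upper bound: base points outside \<open>Q\<close> can only add to the
  average, so \<open>Q\<close> may be shrunk until all of its slices are long.\<close>

lemma measure_ge_of_line_slices: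
  fixes S Q :: "'a::euclidean_space set"
  assumes S: "S \<in> sets borel" "emeasure lborel S < \<infinity>"
    and Q: "Q \<in> sets borel" "emeasure lborel Q < \<infinity>"
    and T: "T > 0" and K: "K \<ge> 0"
    and bd: "\<And>x. x \<in> Q \<Longrightarrow> K \<le> measure lborel {t\<in>{0..T}. x + t *\<^sub>R w \<in> S}"
  shows "K / T * measure lborel Q \<le> measure lborel S"
proof -
  have fin: "emeasure lborel {t\<in>{0..T}. x + t *\<^sub>R w \<in> S} < \<infinity>" for x
    by (rule le_less_trans[OF emeasure_mono[of _ "{0..T}"]]) (use T in auto)
  have "ennreal (K * measure lborel Q) = ennreal K * emeasure lborel Q"
    using Q K by (simp add: emeasure_eq_ennreal_measure ennreal_mult)
  also have "\<dots> = (\<integral>\<^sup>+x. ennreal K * indicator Q x \<partial>lborel)"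
    using Q by (simp add: nn_integral_cmult)
  also have "\<dots> \<le> (\<integral>\<^sup>+x. emeasure lborel {t\<in>{0..T}. x + t *\<^sub>R w \<in> S} \<partial>lborel)"
  proof (rule nn_integral_mono)
    fix x
    have "emeasure lborel {t\<in>{0..T}. x + t *\<^sub>R w \<in> S}
          = ennreal (measure lborel {t\<in>{0..T}. x + t *\<^sub>R w \<in> S})"
      using fin[of x] by (intro emeasure_eq_ennreal_measure) auto
    with bd[of x] show "ennreal K * indicator Q x \<le> emeasure lborel {t\<in>{0..T}. x + t *\<^sub>R w \<in> S}"
      by (auto simp: indicator_def ennreal_leI)
  qed
  also have "\<dots> = ennreal T * emeasure lborel S"
    using nn_integral_line_slices[OF S(1), of T w] T by simp
  also have "\<dots> = ennreal (T * measure lborel S)"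
    using S T by (simp add: emeasure_eq_ennreal_measure ennreal_mult)
  finally have "K * measure lborel Q \<le> T * measure lborel S"
    using T by (subst (asm) ennreal_le_iff) auto
  then show ?thesis
    using T by (simp add: field_simps)
qed

subsection \<open>Affine functions close to perfect squares\<close>

definition near_square :: "real \<Rightarrow> real \<Rightarrow> bool" where
  "near_square \<delta> y \<longleftrightarrow> (\<exists>b::nat. \<bar>y - real b ^ 2\<bar> < \<delta>)"

lemma abs_affine_less_eq:
  fixes p l c d :: real
  assumes "l > 0"
  shows "{t. \<bar>p + l * t - c\<bar> < d} = {(c - d - p) / l <..< (c + d - p) / l}"
  using assms by (auto simp: field_simps abs_less_iff)

lemma measure_near_point_affine:
  fixes p l c d :: real
  assumes "l > 0" "d \<ge> 0"
  shows "measure lborel {t. \<bar>p + l * t - c\<bar> < d} = 2 * d / l"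
proof -
  have "(c - d - p) / l \<le> (c + d - p) / l" using assms by (intro divide_right_mono) auto
  then show ?thesis unfolding abs_affine_less_eq[OF assms(1)]
    using assms by (simp add: field_simps)
qed

lemma near_point_affine_fmeasurable:
  fixes p l c d :: real
  assumes "l > 0"
  shows "{t. \<bar>p + l * t - c\<bar> < d} \<in> fmeasurable lborel"
  unfolding abs_affine_less_eq[OF assms]
  by (rule fmeasurableI) (auto simp: emeasure_lborel_box_eq box_real[symmetric] simp del: box_real)

lemma near_square_affine_slice_fmeasurable:
  fixes p l d T :: real
  assumes "l > 0"
  shows "{t\<in>{0..T}. near_square d (p + l * t)} \<in> fmeasurable lborel"
proof -
  have "{t\<in>{0..T}. near_square d (p + l * t)}
      = {0..T} \<inter> (\<Union>b::nat. {t. \<bar>p + l * t - real b ^ 2\<bar> < d})"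
    by (auto simp: near_square_def)
  moreover have "\<dots> \<in> fmeasurable lborel"
    by (rule fmeasurable_Int_fmeasurable)
      (use near_point_affine_fmeasurable[OF assms] in
        \<open>auto intro!: fmeasurableI sets.countable_UN simp: fmeasurableD emeasure_lborel_Icc_eq\<close>)
  ultimately show ?thesis by simp
qed

lemma near_square_affine_slice_ge_fmeasurable:
  fixes p l d T :: real
  assumes "l > 0"
  shows "{t\<in>{0..T}. near_square d (p + l * t) \<and> c \<le> p + l * t} \<in> fmeasurable lborel"
proof -
  have "{t\<in>{0..T}. near_square d (p + l * t) \<and> c \<le> p + l * t}
      = {t\<in>{0..T}. near_square d (p + l * t)} \<inter> {t. c \<le> p + l * t}" by auto
  moreover have "\<dots> \<in> fmeasurable lborel"
    by (rule fmeasurable_Int_fmeasurable[OF near_square_affine_slice_fmeasurable[OF assms]]) simp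
  ultimately show ?thesis by simp
qed

text \<open>The squares in reach have roots at least M/2, hence gaps of at least M, while the affine
  function moves by l T. This leaves at most 2 + l T / M squares, and each one accounts for a
  parameter interval of length 2 \<delta> / l.\<close>

lemma measure_near_square_affine_le:
  fixes p l \<delta> M T :: real
  assumes l: "l > 0" and d: "0 \<le> \<delta>" "\<delta> \<le> 1" and M: "M \<ge> 2" and T: "T \<ge> 0"
  shows "measure lborel {t\<in>{0..T}. near_square \<delta> (p + l * t) \<and> M ^ 2 \<le> p + l * t}
     \<le> 2 * \<delta> / l * (2 + l * T / M)" (is "measure _ ?E \<le> _")
proof (cases "?E = {}")
  case True
  then show ?thesis using assms by (simp del: Collect_empty_eq)
next
  case False
  define J where "J = {b::nat. \<exists>t\<in>{0..T}. \<bar>p + l * t - real b ^ 2\<bar> < \<delta> \<and> M ^ 2 \<le> p + l * t}"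
  from False have Jne: "J \<noteq> {}" unfolding J_def near_square_def by blast
  \<comment> \<open>Everything is counted from the smallest root in reach: b^2 - m^2 is at least 2 m
    (b - m), and at most l T plus a slack of 2 for the two tolerances.\<close>
  define m where "m = (LEAST b. b \<in> J)"
  have mJ: "m \<in> J" unfolding m_def using Jne by (auto intro: LeastI)
  have mle: "m \<le> b" if "b \<in> J" for b unfolding m_def using that by (rule Least_le)
  obtain s where s: "s \<in> {0..T}" "\<bar>p + l * s - real m ^ 2\<bar> < \<delta>" "M ^ 2 \<le> p + l * s"
    using mJ by (auto simp: J_def)
  have "M^2 - 1 \<le> real m ^ 2" using s d by linarith
  moreover have "(M/2)^2 \<le> M^2 - 1" using M mult_mono[OF M M] by (simp add: power2_eq_square field_simps)
  ultimately have "(M/2)^2 \<le> real m ^ 2" by linarith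
  then have mM: "M / 2 \<le> real m" using M by (metis of_nat_0_le_iff power2_le_imp_le)
  define K where "K = nat \<lfloor>(l * T + 2) / M\<rfloor>"
  have K: "real K \<le> (l * T + 2) / M" unfolding K_def using l T M by simp
  have JK: "J \<subseteq> {m..m+K}"
  proof
    fix b assume b: "b \<in> J"
    then obtain t where t: "t \<in> {0..T}" "\<bar>p + l * t - real b ^ 2\<bar> < \<delta>" by (auto simp: J_def)
    define k where "k = b - m"
    have bk: "b = m + k" using mle[OF b] by (simp add: k_def)
    have "l * t \<le> l * T" "l * s \<ge> 0" using l t s by auto
    then have "real b ^ 2 - real m ^ 2 \<le> l * T + 2" using t s d by linarith
    moreover have "real b ^ 2 - real m ^ 2 = 2 * real m * real k + real k ^ 2"
      by (simp add: bk power2_eq_square algebra_simps)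
    moreover have "M * real k \<le> 2 * real m * real k" using mM by (intro mult_right_mono) auto
    ultimately have "M * real k \<le> l * T + 2"
      using zero_le_power2[of "real k"] by linarith
    then have "real k \<le> (l * T + 2) / M" using M by (simp add: field_simps)
    then have "k \<le> K" unfolding K_def by linarith
    then show "b \<in> {m..m+K}" by (simp add: bk)
  qed
  have fJ: "finite J" using JK finite_subset by blast
  have "measure lborel ?E \<le> measure lborel (\<Union>b\<in>J. {t. \<bar>p + l * t - real b ^ 2\<bar> < \<delta>})"
  proof (rule measure_mono_fmeasurable)
    show "?E \<in> sets lborel"
      using near_square_affine_slice_ge_fmeasurable[OF l] by (rule fmeasurableD)
    show "(\<Union>b\<in>J. {t. \<bar>p + l * t - real b ^ 2\<bar> < \<delta>}) \<in> fmeasurable lborel"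
      using fJ near_point_affine_fmeasurable[OF l] by (rule fmeasurable.finite_UN)
    show "?E \<subseteq> (\<Union>b\<in>J. {t. \<bar>p + l * t - real b ^ 2\<bar> < \<delta>})"
    proof
      fix t assume t: "t \<in> ?E"
      then obtain b :: nat where b: "\<bar>p + l * t - real b ^ 2\<bar> < \<delta>" by (auto simp: near_square_def)
      with t have "b \<in> J" by (auto simp: J_def intro!: bexI[of _ t])
      with b show "t \<in> (\<Union>b\<in>J. {t. \<bar>p + l * t - real b ^ 2\<bar> < \<delta>})" by blast
    qed
  qed
  also have "\<dots> \<le> (\<Sum>b\<in>J. measure lborel {t. \<bar>p + l * t - real b ^ 2\<bar> < \<delta>})"
    using fJ near_point_affine_fmeasurable[OF l] by (intro measure_UNION_le) (auto dest: fmeasurableD)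
  also have "\<dots> = real (card J) * (2 * \<delta> / l)"
    using measure_near_point_affine[OF l d(1)] by simp
  also have "\<dots> \<le> (2 + l * T / M) * (2 * \<delta> / l)"
  proof (rule mult_right_mono)
    have "card J \<le> K + 1" using card_mono[OF _ JK] by simp
    then have "real (card J) \<le> 1 + (l * T + 2) / M" using K by linarith
    also have "\<dots> \<le> 2 + l * T / M" using M by (simp add: field_simps)
    finally show "real (card J) \<le> 2 + l * T / M" .
  qed (use l d in auto)
  finally show ?thesis by (simp add: mult.commute)
qed

text \<open>Squares well inside the range contribute full intervals of length 2 \<delta> / l,
  disjoint because distinct squares differ by at least 1 and \<delta> is at most 1/2. Their roots
  fill an interval of length at least (l T - 2) / (2 R); the condition l T >= 4 R + 4 is exactly
  what leaves l T / (4 R) of them after the loss of 1 to rounding.\<close>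

lemma measure_near_square_affine_ge:
  fixes p l \<delta> R T :: real
  assumes l: "l > 0" and d: "0 \<le> \<delta>" "\<delta> \<le> 1 / 2" and R: "R > 0" and T: "T \<ge> 0"
    and p: "0 \<le> p" "p + l * T \<le> R ^ 2" and big: "l * T \<ge> 4 * R + 4"
  shows "\<delta> * T / (2 * R) \<le> measure lborel {t\<in>{0..T}. near_square \<delta> (p + l * t)}"
    (is "_ \<le> measure _ ?E")
proof -
  \<comment> \<open>The margin of 1 at both ends keeps the whole interval around each chosen square
    within the parameter range.\<close>
  define u v where "u = sqrt (p + 1)" and "v = sqrt (p + l * T - 1)"
  have u2: "u ^ 2 = p + 1" "u \<ge> 0" using p by (auto simp: u_def)
  have v2: "v ^ 2 = p + l * T - 1" "v \<ge> 0" using p big R by (auto simp: v_def)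
  \<comment> \<open>The integers in [u, v], written with an explicit length so that the cardinality
    can be read off.\<close>
  define J where "J = {nat \<lceil>u\<rceil> ..< nat \<lceil>u\<rceil> + nat (\<lfloor>v\<rfloor> - \<lceil>u\<rceil> + 1)}"
  have "v \<le> R"
  proof (rule power2_le_imp_le)
    show "v\<^sup>2 \<le> R\<^sup>2" using v2 p by linarith
  qed (use R in auto)
  moreover have uR: "u \<le> R"
  proof (rule power2_le_imp_le)
    show "u\<^sup>2 \<le> R\<^sup>2" using u2 p big R by linarith
  qed (use R in auto)
  ultimately have uv: "u + v \<le> 2 * R" by simp
  have prod: "(v - u) * (u + v) = l * T - 2" using u2 v2 by (simp add: algebra_simps power2_eq_square)
  have "v - u > 0"
  proof (rule ccontr)
    assume "\<not> ?thesis"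
    then have "(v - u) * (u + v) \<le> 0" using u2 v2 by (intro mult_nonpos_nonneg) auto
    then show False using prod big R by linarith
  qed
  then have "(v - u) * (u + v) \<le> (v - u) * (2 * R)" using uv by (intro mult_left_mono) auto
  then have "l * T - 2 \<le> (v - u) * (2 * R)" using prod by simp
  then have vu: "v - u \<ge> (l * T - 2) / (2 * R)" using R by (simp add: field_simps)
  have "real_of_int (\<lfloor>v\<rfloor> - \<lceil>u\<rceil> + 1) \<ge> v - u - 1"
    by linarith
  also have "v - u - 1 \<ge> l * T / (4 * R)"
  proof -
    have "(l * T - 2) / (2 * R) - 1 \<ge> l * T / (4 * R)"
      using big R by (simp add: field_simps)
    then show ?thesis using vu by linarith
  qed
  finally have cJ: "real (card J) \<ge> l * T / (4 * R)"
    by (simp add: J_def)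
  have bJ: "p + 1 \<le> real b ^ 2 \<and> real b ^ 2 \<le> p + l * T - 1" if "b \<in> J" for b
  proof -
    have "u \<le> real b \<and> real b \<le> v"
      using that u2(2) v2(2) unfolding J_def by (simp; linarith)
    then have "u^2 \<le> real b ^ 2" "real b ^ 2 \<le> v^2" using u2(2) by (auto intro!: power_mono)
    then show ?thesis unfolding u2(1) v2(1) by blast
  qed
  let ?I = "\<lambda>b::nat. {t. \<bar>p + l * t - real b ^ 2\<bar> < \<delta>}"
  have dis: "disjoint_family_on ?I J"
  proof (unfold disjoint_family_on_def, intro ballI impI)
    fix b c assume "b \<in> J" "c \<in> J" "b \<noteq> c"
    then have "b ^ 2 \<noteq> c ^ 2" by (metis power2_eq_iff_nonneg zero_le)
    then have "b ^ 2 + 1 \<le> c ^ 2 \<or> c ^ 2 + 1 \<le> b ^ 2" by linarith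
    then have "real (b ^ 2 + 1) \<le> real (c ^ 2) \<or> real (c ^ 2 + 1) \<le> real (b ^ 2)"
      by (simp only: of_nat_le_iff)
    then have sep: "\<bar>real b ^ 2 - real c ^ 2\<bar> \<ge> 1"
      unfolding of_nat_add of_nat_1 of_nat_power by linarith
    show "?I b \<inter> ?I c = {}"
    proof (rule equals0I)
      fix t assume "t \<in> ?I b \<inter> ?I c"
      then have "\<bar>p + l * t - real b ^ 2\<bar> < \<delta>" "\<bar>p + l * t - real c ^ 2\<bar> < \<delta>" by auto
      then show False using sep d by linarith
    qed
  qed
  have "\<delta> * T / (2 * R) = l * T / (4 * R) * (2 * \<delta> / l)" using l R by (simp add: field_simps)
  also have "\<dots> \<le> real (card J) * (2 * \<delta> / l)"
    using cJ l d by (intro mult_right_mono) auto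
  also have "\<dots> = (\<Sum>b\<in>J. measure lborel (?I b))"
    using measure_near_point_affine[OF l d(1)] by simp
  also have "\<dots> = measure lborel (\<Union>b\<in>J. ?I b)"
    by (rule measure_finite_Union[symmetric, OF _ _ dis])
      (use near_point_affine_fmeasurable[OF l] in \<open>auto simp: J_def fmeasurable_def less_top\<close>)
  also have "\<dots> \<le> measure lborel ?E"
  proof (rule measure_mono_fmeasurable)
    show "(\<Union>b\<in>J. ?I b) \<subseteq> ?E"
    proof clarify
      fix b t assume b: "b \<in> J" and t: "\<bar>p + l * t - real b ^ 2\<bar> < \<delta>"
      have "l * t \<ge> 0" "l * t \<le> l * T" using bJ[OF b] t d by linarith+
      then have "t \<in> {0..T}" using l by (auto simp: zero_le_mult_iff)
      then show "t \<in> {0..T} \<and> near_square \<delta> (p + l * t)"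
        using t by (auto simp: near_square_def)
    qed
    show "?E \<in> fmeasurable lborel" by (rule near_square_affine_slice_fmeasurable[OF l])
    show "(\<Union>b\<in>J. ?I b) \<in> sets lborel"
      using near_point_affine_fmeasurable[OF l] by (auto simp: J_def dest!: fmeasurableD)
  qed
  finally show ?thesis .
qed

subsection \<open>Coprime pairs and blocks of integer vectors\<close>

text \<open>Telescoping of 1 / (M (M + 1)), started at M = 2, where both sides equal 1/4. What
  matters later is that the bound stays below 1.\<close>

lemma sum_inverse_squares_le:
  assumes "M \<ge> 2"
  shows "(\<Sum>g=2..M. 1 / real g ^ 2) \<le> 3 / 4 - 1 / real M"
  using assms
proof (induction M rule: dec_induct)
  case base
  show ?case by (simp add: power2_eq_square)
next
  case (step M)
  have "1 / real (Suc M) ^ 2 \<le> 1 / real M - 1 / real (Suc M)"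
  proof -
    have "1 / real M - 1 / real (Suc M) = 1 / (real M * real (Suc M))"
      using step.hyps by (simp add: field_simps)
    moreover have "1 / real (Suc M) ^ 2 \<le> 1 / (real M * real (Suc M))"
      unfolding power2_eq_square using step.hyps by (intro divide_left_mono mult_right_mono) auto
    ultimately show ?thesis by simp
  qed
  then show ?case using step by simp
qed

text \<open>Sort the pairs by their gcd g. Division by g embeds a class into a square of side M / g,
  so the classes with g >= 2 take up at most 3/4 of all pairs.\<close>

lemma card_coprime_pairs_ge:
  "real M ^ 2 \<le> 4 * real (card {(u, v). u \<in> {1..M} \<and> v \<in> {1..M} \<and> coprime u v})"
proof (cases "M \<ge> 2")
  case False
  then consider "M = 0" | "M = 1" by linarith
  then show ?thesis
  proof cases
    case 2
    then have "{(u, v). u \<in> {1..M} \<and> v \<in> {1..M} \<and> coprime u v} = {(1, 1)}" by auto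
    with 2 show ?thesis by simp
  qed auto
next
  case M: True
  define G where "G g = {(u, v). u \<in> {1..M} \<and> v \<in> {1..M} \<and> gcd u v = g}" for g
  have fG: "finite (G g)" for g
    by (rule finite_subset[of _ "{1..M} \<times> {1..M}"]) (auto simp: G_def)
  have cG: "real (card (G g)) \<le> real M ^ 2 * (1 / real g ^ 2)" if g: "g \<ge> 1" for g
  proof -
    have "inj_on (\<lambda>(u, v). (u div g, v div g)) (G g)"
    proof (rule inj_onI, clarsimp simp: G_def)
      fix u v u' v' assume "g = gcd u v" "gcd u' v' = gcd u v"
        and "u div gcd u v = u' div gcd u v" "v div gcd u v = v' div gcd u v"
      then show "u = u' \<and> v = v'"
        by (metis dvd_div_mult_self gcd_dvd1 gcd_dvd2)
    qed
    moreover have "(\<lambda>(u, v). (u div g, v div g)) ` G g \<subseteq> {1..M div g} \<times> {1..M div g}"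
      using g by (auto simp: G_def div_le_mono Suc_le_eq div_greater_zero_iff intro!: dvd_imp_le)
    ultimately have "card (G g) \<le> card ({1..M div g} \<times> {1..M div g})"
      by (rule card_inj_on_le) auto
    then have "card (G g) \<le> (M div g) ^ 2" by (simp add: power2_eq_square)
    then have "real (card (G g)) \<le> real (M div g) ^ 2"
      by (metis of_nat_le_iff of_nat_power)
    also have "\<dots> \<le> (real M / real g) ^ 2"
      by (intro power_mono) (auto intro: of_nat_div_le_of_nat)
    finally show ?thesis by (simp add: power_divide)
  qed
  have "{1..M} \<times> {1..M} = (\<Union>g\<in>{1..M}. G g)"
    by (auto simp: G_def Suc_le_eq) (meson dvd_imp_le gcd_dvd1 le_trans)
  then have "card ({1..M} \<times> {1..M}) = (\<Sum>g\<in>{1..M}. card (G g))"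
    by (simp only:) (rule card_UN_disjoint, auto simp: fG, auto simp: G_def)
  then have "real M ^ 2 = (\<Sum>g\<in>{1..M}. real (card (G g)))"
    by (simp add: power2_eq_square flip: of_nat_sum of_nat_mult)
  also have "{1..M} = insert 1 {2..M}" using M by auto
  also have "(\<Sum>g\<in>insert 1 {2..M}. real (card (G g)))
      = real (card (G 1)) + (\<Sum>g=2..M. real (card (G g)))" by simp
  also have "(\<Sum>g=2..M. real (card (G g))) \<le> (\<Sum>g=2..M. real M ^ 2 * (1 / real g ^ 2))"
    by (intro sum_mono cG) auto
  also have "\<dots> = real M ^ 2 * (\<Sum>g=2..M. 1 / real g ^ 2)" by (simp add: sum_distrib_left)
  also have "\<dots> \<le> real M ^ 2 * (3 / 4)"
  proof (rule mult_left_mono)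
    have "0 \<le> 1 / real M" by simp
    then show "(\<Sum>g=2..M. 1 / real g ^ 2) \<le> 3 / 4"
      using sum_inverse_squares_le[OF M] by linarith
  qed simp
  finally have "real M ^ 2 \<le> 4 * real (card (G 1))" by simp
  also have "G 1 = {(u, v). u \<in> {1..M} \<and> v \<in> {1..M} \<and> coprime u v}"
    by (auto simp: G_def coprime_iff_gcd_eq_1)
  finally show ?thesis .
qed

text \<open>The ratio 16 makes the count work: at least 64 N^2 pairs in [1, 16 N]^2 are coprime, and at most
  32 N^2 of them have an entry that is at most N.\<close>

definition coprime_block :: "nat \<Rightarrow> (nat \<times> nat) set" where
  "coprime_block N = {(u, v). u \<in> {N<..16 * N} \<and> v \<in> {N<..16 * N} \<and> coprime u v}"

lemma finite_coprime_block: "finite (coprime_block N)"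
  by (rule finite_subset[of _ "{N<..16 * N} \<times> {N<..16 * N}"]) (auto simp: coprime_block_def)

lemma card_coprime_block_ge: "real N ^ 2 \<le> real (card (coprime_block N))"
proof -
  let ?A = "{(u, v). u \<in> {1..16 * N} \<and> v \<in> {1..16 * N} \<and> coprime u v}"
  let ?B = "{1..N} \<times> {1..16 * N} \<union> {1..16 * N} \<times> {1..N}"
  have "?A \<subseteq> coprime_block N \<union> ?B" by (auto simp: coprime_block_def)
  then have "card ?A \<le> card (coprime_block N \<union> ?B)"
    by (intro card_mono) (auto simp: finite_coprime_block)
  also have "\<dots> \<le> card (coprime_block N) + card ?B" by (rule card_Un_le)
  also have "card ?B \<le> 32 * N ^ 2"
    by (rule order_trans[OF card_Un_le]) (simp add: power2_eq_square)
  finally have "real (card ?A) \<le> real (card (coprime_block N) + 32 * N ^ 2)"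
    by (subst of_nat_le_iff) simp
  then have "real (card ?A) \<le> real (card (coprime_block N)) + 32 * real N ^ 2" by simp
  moreover have "256 * real N ^ 2 \<le> 4 * real (card ?A)"
    using card_coprime_pairs_ge[of "16 * N"] by (simp add: power_mult_distrib)
  ultimately show ?thesis by linarith
qed

lemma sum_inverse_le_ln: "(\<Sum>d=1..m. 1 / real d) \<le> 1 + ln (real (max m 1))"
proof (induction m)
  case (Suc m)
  show ?case
  proof (cases "m = 0")
    case False
    have "ln (real m / real (Suc m)) \<le> real m / real (Suc m) - 1"
      using False by (intro ln_le_minus_one) auto
    then have "1 / real (Suc m) \<le> ln (real (Suc m)) - ln (real m)"
      using False by (simp add: ln_div field_simps)
    moreover have "max m 1 = m" "max (Suc m) 1 = Suc m" using False by auto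
    ultimately show ?thesis using Suc by (simp only: sum.cl_ivl_Suc) simp
  qed auto
qed auto

section \<open>Determinants of coprime pairs\<close>

definition pair_det :: "nat \<times> nat \<Rightarrow> nat \<times> nat \<Rightarrow> int" where
  "pair_det z z' = int (fst z) * int (snd z') - int (snd z) * int (fst z')"

lemma pair_det_bound:
  assumes "z \<in> coprime_block N" "z' \<in> coprime_block N'"
  shows "\<bar>pair_det z z'\<bar> \<le> int (256 * N * N')"
proof -
  have "fst z * snd z' \<le> (16 * N) * (16 * N')" "snd z * fst z' \<le> (16 * N) * (16 * N')"
    using assms by (intro mult_le_mono; auto simp: coprime_block_def)+
  then have "int (fst z * snd z') \<le> int (256 * N * N')" "int (snd z * fst z') \<le> int (256 * N * N')"
    by (auto simp del: of_nat_mult)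
  moreover have "0 \<le> int (fst z * snd z')" "0 \<le> int (snd z * fst z')" by simp_all
  ultimately show ?thesis unfolding pair_det_def of_nat_mult by linarith
qed

text \<open>For a fixed coprime pair z = (u, v), two pairs with the same determinant against z
  differ by a multiple of z. Their first entries are therefore congruent modulo u, and the quotient
  by u separates them.\<close>

lemma inj_on_det_div:
  assumes "coprime (fst z) (snd z)" "fst z > 0"
  shows "inj (\<lambda>z'. (pair_det z z', fst z' div fst z))"
proof (rule injI)
  fix x y :: "nat \<times> nat"
  obtain u v where z: "z = (u, v)" by force
  assume "(pair_det z x, fst x div fst z) = (pair_det z y, fst y div fst z)"
  then have det: "int u * (int (snd x) - int (snd y)) = int v * (int (fst x) - int (fst y))"
    and dv: "fst x div u = fst y div u"
    by (auto simp: pair_det_def z algebra_simps)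
  have u: "u > 0" and cop: "coprime (int u) (int v)" using assms by (auto simp: z)
  have "int u dvd int v * (int (fst x) - int (fst y))" by (metis det dvd_triv_left)
  then have "int u dvd int (fst x) - int (fst y)" using cop coprime_dvd_mult_right_iff by blast
  then have "int (fst x) mod int u = int (fst y) mod int u" by (simp add: mod_eq_dvd_iff)
  then have "fst x mod u = fst y mod u" by (simp flip: of_nat_mod)
  then have eq: "fst x = fst y" using dv by (metis div_mult_mod_eq)
  then have "snd x = snd y" using det u by simp
  with eq show "x = y" by (simp add: prod_eq_iff)
qed

text \<open>Proportional primitive vectors agree: coprimality on either side turns the
  cross-multiplied equation into mutual divisibility of the first entries.\<close>

lemma pair_det_eq_0_imp_eq:
  assumes "pair_det z y = 0" and zc: "coprime (fst z) (snd z)" and yc: "coprime (fst y) (snd y)"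
    and "fst z > 0"
  shows "y = z"
proof -
  have "int (fst z * snd y) = int (snd z * fst y)" using assms by (auto simp: pair_det_def)
  then have e: "fst z * snd y = snd z * fst y" by (simp only: of_nat_eq_iff)
  have "fst z dvd fst y" using e zc by (metis coprime_dvd_mult_right_iff dvd_triv_left)
  moreover have "fst y dvd fst z" using e yc
    by (metis coprime_commute coprime_dvd_mult_left_iff dvd_triv_right)
  ultimately have "fst y = fst z" by (simp add: dvd_antisym)
  then show ?thesis using e assms by (auto simp: prod_eq_iff)
qed

text \<open>For coprime pairs a vanishing determinant means that the pairs agree; the weight 1 is then the
  correct one because another coordinate of the two vectors differs, which gives a minor of size at least N.\<close>

definition det_weight :: "nat \<Rightarrow> nat \<times> nat \<Rightarrow> nat \<times> nat \<Rightarrow> real" where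
  "det_weight N z z' = (if pair_det z z' = 0 then 1 else real N / \<bar>real_of_int (pair_det z z')\<bar>)"

lemma sum_inverse_abs_int:
  "(\<Sum>d | d \<noteq> 0 \<and> \<bar>d\<bar> \<le> int m. 1 / \<bar>real_of_int d\<bar>) = 2 * (\<Sum>d=1..m. 1 / real d)"
proof -
  have "{d. d \<noteq> 0 \<and> \<bar>d\<bar> \<le> int m} = int ` {1..m} \<union> (\<lambda>d. - int d) ` {1..m}"
  proof (intro equalityI subsetI)
    fix d assume "d \<in> {d. d \<noteq> 0 \<and> \<bar>d\<bar> \<le> int m}"
    then have d: "d \<noteq> 0" "\<bar>d\<bar> \<le> int m" by auto
    show "d \<in> int ` {1..m} \<union> (\<lambda>d. - int d) ` {1..m}"
    proof (cases "d > 0")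
      case True
      then have "d = int (nat d)" "nat d \<in> {1..m}" using d by auto
      then show ?thesis by blast
    next
      case False
      then have "d = - int (nat (- d))" "nat (- d) \<in> {1..m}" using d by auto
      then show ?thesis by blast
    qed
  qed auto
  moreover have "int ` {1..m} \<inter> (\<lambda>d. - int d) ` {1..m} = {}" by auto
  moreover have "(\<Sum>d\<in>int ` {1..m}. 1 / \<bar>real_of_int d\<bar>) = (\<Sum>d=1..m. 1 / real d)"
    by (subst sum.reindex) (auto simp: inj_on_def)
  moreover have "(\<Sum>d\<in>(\<lambda>d. - int d) ` {1..m}. 1 / \<bar>real_of_int d\<bar>) = (\<Sum>d=1..m. 1 / real d)"
    by (subst sum.reindex) (auto simp: inj_on_def)
  ultimately show ?thesis by (simp add: sum.union_disjoint)
qed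

text \<open>By \<open>inj_on_det_div\<close> each non-zero determinant d, with |d| at most 256 N N',
  occurs for at most 17 N' / N pairs. The sum of 1 / |d| gives the logarithm, and the factor N of
  the weight cancels the 1 / N. The final summand 1 stands for z' = z, the only pair with
  determinant 0.\<close>

lemma sum_det_weight_le:
  assumes z: "z \<in> coprime_block N" and N: "1 \<le> N" "N \<le> N'"
  shows "(\<Sum>z'\<in>coprime_block N'. det_weight N z z') \<le> 34 * real N' * (1 + ln (256 * real N' ^ 2)) + 1"
proof -
  have zc: "coprime (fst z) (snd z)" "fst z > N" using z by (auto simp: coprime_block_def)
  let ?C = "coprime_block N'"
  let ?A = "{z'\<in>?C. pair_det z z' \<noteq> 0}" and ?B = "{z'\<in>?C. pair_det z z' = 0}"
  let ?m = "256 * N * N'"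
  let ?D = "{d. d \<noteq> 0 \<and> \<bar>d\<bar> \<le> int ?m}" and ?K = "{0..16 * N' div N}"
  let ?F = "\<lambda>z'. (pair_det z z', fst z' div fst z)"
  have fD: "finite ?D" by (rule finite_subset[of _ "{- int ?m..int ?m}"]) auto
  have "?B \<subseteq> {z}"
    using pair_det_eq_0_imp_eq[of z] zc by (auto simp: coprime_block_def)
  then have cB: "real (card ?B) \<le> 1" using card_mono[of "{z}" ?B] by simp
  have inj: "inj_on ?F ?A"
    using inj_on_det_div[of z] zc by (auto intro: inj_on_subset)
  have img: "?F ` ?A \<subseteq> ?D \<times> ?K"
  proof clarsimp
    fix u v assume uv: "(u, v) \<in> ?C"
    have "u div fst z \<le> u div N" using zc N by (intro div_le_mono2) auto
    also have "\<dots> \<le> 16 * N' div N" using uv by (intro div_le_mono) (auto simp: coprime_block_def)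
    finally show "\<bar>pair_det z (u, v)\<bar> \<le> 256 * int N * int N' \<and> u div fst z \<le> 16 * N' div N"
      using pair_det_bound[OF z uv] by simp
  qed
  have "(\<Sum>z'\<in>?A. 1 / \<bar>real_of_int (pair_det z z')\<bar>) = (\<Sum>(d, k)\<in>?F ` ?A. 1 / \<bar>real_of_int d\<bar>)"
    by (subst sum.reindex[OF inj]) (auto simp: case_prod_unfold)
  also have "\<dots> \<le> (\<Sum>(d, k)\<in>?D \<times> ?K. 1 / \<bar>real_of_int d\<bar>)"
    using fD img by (intro sum_mono2) auto
  also have "\<dots> = real (card ?K) * (\<Sum>d\<in>?D. 1 / \<bar>real_of_int d\<bar>)"
    by (simp add: sum.cartesian_product[symmetric] sum_distrib_left)
  also have "\<dots> = real (card ?K) * (2 * (\<Sum>d=1..?m. 1 / real d))"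
    by (simp only: sum_inverse_abs_int)
  also have "\<dots> \<le> (17 * real N' / real N) * (2 * (1 + ln (256 * real N' ^ 2)))"
  proof (intro mult_mono mult_left_mono)
    have "real (16 * N' div N) \<le> real (16 * N') / real N" by (rule of_nat_div_le_of_nat)
    moreover have "1 \<le> real N' / real N" using N by simp
    moreover have "17 * real N' / real N = real (16 * N') / real N + real N' / real N"
      by (simp add: add_divide_distrib[symmetric])
    ultimately show "real (card ?K) \<le> 17 * real N' / real N" by simp
    have "(\<Sum>d=1..?m. 1 / real d) \<le> 1 + ln (real (max ?m 1))" by (rule sum_inverse_le_ln)
    also have "max ?m 1 = ?m" using N by (intro max_absorb1) (simp add: Suc_le_eq)
    also have "ln (real ?m) \<le> ln (256 * real N' ^ 2)"
    proof (subst ln_le_cancel_iff)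
      have "real N * real N' \<le> real N' * real N'" using N by (intro mult_right_mono) auto
      then show "real ?m \<le> 256 * real N' ^ 2" by (simp add: power2_eq_square)
    qed (use N in auto)
    finally show "(\<Sum>d=1..?m. 1 / real d) \<le> 1 + ln (256 * real N' ^ 2)" by simp
  qed (auto intro: sum_nonneg)
  finally have "real N * (\<Sum>z'\<in>?A. 1 / \<bar>real_of_int (pair_det z z')\<bar>)
      \<le> real N * ((17 * real N' / real N) * (2 * (1 + ln (256 * real N' ^ 2))))"
    by (rule mult_left_mono) simp
  also have "\<dots> = 34 * real N' * (1 + ln (256 * real N' ^ 2))" using N by simp
  finally have A: "(\<Sum>z'\<in>?A. det_weight N z z') \<le> 34 * real N' * (1 + ln (256 * real N' ^ 2))"
    by (simp add: det_weight_def sum_distrib_left)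
  have "(\<Sum>z'\<in>?C. det_weight N z z') = (\<Sum>z'\<in>?A. det_weight N z z') + (\<Sum>z'\<in>?B. det_weight N z z')"
    by (subst sum.union_disjoint[symmetric]) (auto simp: finite_coprime_block intro!: sum.cong)
  also have "(\<Sum>z'\<in>?B. det_weight N z z') = real (card ?B)"
    by (simp add: det_weight_def)
  finally show ?thesis using A cB by linarith
qed

text \<open>Coprimality of two coordinates makes all vectors in all blocks pairwise non-parallel.\<close>

definition vector_block :: "'n::finite \<Rightarrow> 'n \<Rightarrow> nat \<Rightarrow> ('n \<Rightarrow> nat) set" where
  "vector_block p q N = {a. (\<forall>i. a i \<in> {N<..16 * N}) \<and> coprime (a p) (a q)}"

text \<open>A block is the product of \<open>coprime_block\<close> with a full box in the remaining
  coordinates, which carry no condition linking them to \<open>p\<close> and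
  \<open>q\<close>.\<close>

lemma sum_vector_block:
  fixes p q :: "'n::finite" and f :: "nat \<times> nat \<Rightarrow> real"
  assumes pq: "p \<noteq> q"
  shows "(\<Sum>a\<in>vector_block p q N. f (a p, a q))
    = (15 * real N) ^ (CARD('n) - 2) * (\<Sum>z\<in>coprime_block N. f z)"
proof -
  let ?R = "- {p, q}" and ?E = "PiE (- {p, q}) (\<lambda>_. {N<..16 * N})"
  let ?h = "\<lambda>(z :: nat \<times> nat, g :: 'n \<Rightarrow> nat) i. if i = p then fst z else if i = q then snd z else g i"
  have bij: "bij_betw ?h (coprime_block N \<times> ?E) (vector_block p q N)"
  proof (rule bij_betw_byWitness[where f' = "\<lambda>a. ((a p, a q), restrict a ?R)"])
    show "\<forall>x\<in>coprime_block N \<times> ?E. ((?h x p, ?h x q), restrict (?h x) ?R) = x"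
      using pq by (auto simp: restrict_def PiE_def extensional_def fun_eq_iff)
    show "\<forall>a\<in>vector_block p q N. ?h ((a p, a q), restrict a ?R) = a"
      by (auto simp: fun_eq_iff)
    show "?h ` (coprime_block N \<times> ?E) \<subseteq> vector_block p q N"
    proof clarify
      fix u v g assume "(u, v) \<in> coprime_block N" "g \<in> ?E"
      then show "(\<lambda>i. if i = p then fst (u, v) else if i = q then snd (u, v) else g i) \<in> vector_block p q N"
        using pq by (auto simp: coprime_block_def vector_block_def PiE_def Pi_def)
    qed
    show "(\<lambda>a. ((a p, a q), restrict a ?R)) ` vector_block p q N \<subseteq> coprime_block N \<times> ?E"
      by (intro image_subsetI, unfold mem_Times_iff fst_conv snd_conv restrict_PiE_iff)
        (simp add: coprime_block_def vector_block_def)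
  qed
  have "(\<Sum>a\<in>vector_block p q N. f (a p, a q))
      = (\<Sum>x\<in>coprime_block N \<times> ?E. f (?h x p, ?h x q))"
    by (rule sum.reindex_bij_betw[OF bij, symmetric])
  also have "\<dots> = (\<Sum>x\<in>coprime_block N \<times> ?E. f (fst x))"
    using pq by (intro sum.cong refl) (simp add: case_prod_unfold)
  also have "\<dots> = (\<Sum>z\<in>coprime_block N. real (card ?E) * f z)"
    unfolding sum.cartesian_product' by simp
  also have "card ?E = (15 * N) ^ (CARD('n) - 2)"
    using pq by (simp add: card_PiE Compl_eq_Diff_UNIV card_Diff_subset numeral_2_eq_2)
  finally show ?thesis by (simp add: sum_distrib_left)
qed

lemma vector_block_subset_PiE: "vector_block p q N \<subseteq> PiE UNIV (\<lambda>_. {N<..16 * N})"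
  by (auto simp: vector_block_def)

lemma finite_vector_block: "finite (vector_block p q N)"
  by (rule finite_subset[OF vector_block_subset_PiE]) (auto intro: finite_PiE)

lemma card_vector_block_le:
  fixes p q :: "'n::finite"
  shows "real (card (vector_block p q N)) \<le> 16 ^ CARD('n) * real N ^ CARD('n)"
proof -
  have "card (vector_block p q N) \<le> card (PiE (UNIV :: 'n set) (\<lambda>_. {N<..16 * N}))"
    by (rule card_mono[OF _ vector_block_subset_PiE]) (auto intro: finite_PiE)
  also have "\<dots> = (15 * N) ^ CARD('n)" by (simp add: card_PiE)
  also have "\<dots> \<le> (16 * N) ^ CARD('n)" by (intro power_mono) auto
  finally have "real (card (vector_block p q N)) \<le> real ((16 * N) ^ CARD('n))"
    by (subst of_nat_le_iff)
  then show ?thesis by (simp add: power_mult_distrib)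
qed

lemma card_vector_block_ge:
  fixes p q :: "'n::finite"
  assumes pq: "p \<noteq> q"
  shows "real N ^ CARD('n) \<le> real (card (vector_block p q N))"
proof -
  have "CARD('n) \<ge> card {p, q}" by (rule card_mono) auto
  then have n: "CARD('n) = (CARD('n) - 2) + 2" using pq by simp
  have "real N ^ CARD('n) = real N ^ (CARD('n) - 2) * real N ^ 2"
    by (subst n) (rule power_add)
  also have "\<dots> \<le> (15 * real N) ^ (CARD('n) - 2) * real (card (coprime_block N))"
    by (intro mult_mono power_mono card_coprime_block_ge) auto
  also have "\<dots> = real (card (vector_block p q N))"
    using sum_vector_block[OF pq, of "\<lambda>_. 1" N] by simp
  finally show ?thesis .
qed

lemma sum_vector_block_det_weight_le:
  fixes p q :: "'n::finite"
  assumes pq: "p \<noteq> q" and a: "a \<in> vector_block p q N" and N: "1 \<le> N" "N \<le> N'"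
  shows "(\<Sum>a'\<in>vector_block p q N'. det_weight N (a p, a q) (a' p, a' q))
    \<le> (15 * real N') ^ (CARD('n) - 2) * (34 * real N' * (1 + ln (256 * real N' ^ 2)) + 1)"
  unfolding sum_vector_block[OF pq]
  by (intro mult_left_mono sum_det_weight_le[OF _ N])
    (use a in \<open>auto simp: vector_block_def coprime_block_def\<close>)

subsection \<open>The resonant sets inside a cube\<close>

definition square_form :: "('n::finite \<Rightarrow> nat) \<Rightarrow> real ^ 'n \<Rightarrow> real" where
  "square_form a x = (\<Sum>i\<in>UNIV. real (a i) ^ 2 * x $ i)"

lemma square_form_add_scaleR:
  "square_form a (x + t *\<^sub>R w) = square_form a x + square_form a w * t"
  by (simp add: square_form_def sum.distrib distrib_left sum_distrib_right mult.assoc mult.commute[of t])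

lemma square_form_axis: "square_form a (axis i 1) = real (a i) ^ 2"
  by (simp add: square_form_def axis_def if_distrib cong: if_cong)

lemma continuous_on_square_form: "continuous_on S (square_form a)"
  unfolding square_form_def by (intro continuous_intros)

lemma square_form_ge_component:
  assumes "\<And>k. 0 \<le> x $ k"
  shows "real (a i) ^ 2 * x $ i \<le> square_form a x"
  unfolding square_form_def
  by (rule member_le_sum) (use assms in auto)

lemma square_form_le:
  fixes x :: "real ^ 'n::finite"
  assumes "\<And>k. 0 \<le> x $ k \<and> x $ k \<le> 1" and "\<And>k. a k \<le> h"
  shows "square_form a x \<le> real CARD('n) * real h ^ 2"
proof -
  have "square_form a x \<le> (\<Sum>i\<in>(UNIV :: 'n set). real h ^ 2 * 1)"
    unfolding square_form_def
    by (intro sum_mono mult_mono power_mono) (use assms in auto)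
  then show ?thesis by simp
qed

definition near_set :: "('n::finite \<Rightarrow> nat) \<Rightarrow> real \<Rightarrow> (real ^ 'n) set" where
  "near_set a \<delta> = {x. near_square \<delta> (square_form a x)}"

lemma borel_near_set [measurable]: "near_set a \<delta> \<in> sets borel"
proof -
  have "near_set a \<delta> = (\<Union>b::nat. {x. \<bar>square_form a x - real b ^ 2\<bar> < \<delta>})"
    by (auto simp: near_set_def near_square_def)
  moreover have "open \<dots>"
    by (intro open_UN ballI open_Collect_less continuous_intros continuous_on_square_form)
  ultimately show ?thesis by simp
qed

lemma borel_line_slice:
  fixes S :: "'a::euclidean_space set"
  assumes [measurable]: "S \<in> sets borel"
  shows "{t\<in>{0..T}. x + t *\<^sub>R w \<in> S} \<in> sets borel"
  by measurable

lemma borel_square_form_ge: "{x. c \<le> square_form a x} \<in> sets borel"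
  by (intro borel_closed closed_Collect_le continuous_intros continuous_on_square_form)

section \<open>Resonant sets in cubes: single sets and pairwise intersections\<close>

definition cube :: "real ^ 'n::finite \<Rightarrow> real \<Rightarrow> (real ^ 'n) set" where
  "cube c r = cbox c (\<chi> i. c $ i + r)"

lemma mem_cube: "x \<in> cube c r \<longleftrightarrow> (\<forall>i. c $ i \<le> x $ i \<and> x $ i \<le> c $ i + r)"
  by (simp add: cube_def mem_box_cart)

lemma measure_cube:
  fixes c :: "real ^ 'n::finite"
  assumes "r \<ge> 0" shows "measure lborel (cube c r) = r ^ CARD('n)"
proof -
  have "c \<in> cube c r" using assms by (simp add: mem_cube)
  then have "cbox c (\<chi> i. c $ i + r) \<noteq> {}" by (auto simp: cube_def)
  then show ?thesis unfolding cube_def by (subst content_cbox_cart) auto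
qed

lemma cube_fmeasurable: "cube c r \<in> fmeasurable lborel"
  unfolding cube_def by (rule fmeasurable_cbox)

lemma borel_cube: "cube c r \<in> sets borel"
  unfolding cube_def by simp

lemma fmeasurable_Int_cube:
  "A \<in> sets borel \<Longrightarrow> A \<inter> cube c r \<in> fmeasurable lborel"
  using fmeasurable_Int_fmeasurable[OF cube_fmeasurable, of A c r] by (simp add: Int_commute)

lemma fmeasurable_lborelD:
  assumes "A \<in> fmeasurable lborel"
  shows "A \<in> sets borel" "emeasure lborel A < \<infinity>"
  using assms by (auto simp: fmeasurable_def)

text \<open>Segments of length r/2 in a coordinate direction stay in the cube when they start in the
  corner cube of half the side. Along them the form grows by at least N^2 r / 2; the constant 256
  makes this at least 4 R + 4, as \<open>measure_near_square_affine_ge\<close> requires.\<close>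

lemma measure_near_set_cube_ge:
  fixes a :: "'n::finite \<Rightarrow> nat"
  assumes a: "\<And>i. N < a i \<and> a i \<le> 16 * N" and c: "\<And>i. 0 \<le> c $ i \<and> c $ i + r \<le> 1"
    and r: "r > 0" and d: "0 \<le> \<delta>" "\<delta> \<le> 1 / 2" and big: "real N * r \<ge> 256 * real CARD('n)"
  shows "\<delta> / (32 * real CARD('n) * real N) * (r / 2) ^ CARD('n) \<le> measure lborel (near_set a \<delta> \<inter> cube c r)"
proof -
  \<comment> \<open>On the unit cube the form is at most n (16 N)^2, hence at most (16 n
    N)^2.\<close>
  define R where "R = 16 * real CARD('n) * real N"
  \<comment> \<open>Any coordinate direction serves, because every entry exceeds
    \<open>N\<close>.\<close>
  define p :: 'n where "p = undefined"
  have n: "real CARD('n) \<ge> 1" by (simp add: Suc_le_eq)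
  have N: "real N > 0" using a[of p] by auto
  have R: "R > 0" using n N by (simp add: R_def)
  have ap: "real N ^ 2 \<le> real (a p) ^ 2" using a[of p] by (intro power_mono) auto
  have "measure lborel (cube c (r / 2)) = (r / 2) ^ CARD('n)" using r by (simp add: measure_cube)
  moreover have "\<delta> * (r / 2) / (2 * R) / (r / 2) * measure lborel (cube c (r / 2))
      \<le> measure lborel (near_set a \<delta> \<inter> cube c r)"
  proof (rule measure_ge_of_line_slices[where w = "axis p 1"])
    fix x assume x: "x \<in> cube c (r / 2)"
    have cu: "x + t *\<^sub>R axis p 1 \<in> cube c r" if "t \<in> {0..r / 2}" for t
      unfolding mem_cube
    proof
      fix k
      have "0 \<le> t * axis p 1 $ k \<and> t * axis p 1 $ k \<le> r / 2" using that r by (simp add: axis_def)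
      moreover have "c $ k \<le> x $ k \<and> x $ k \<le> c $ k + r / 2" using x by (simp add: mem_cube)
      ultimately show "c $ k \<le> (x + t *\<^sub>R axis p 1) $ k \<and> (x + t *\<^sub>R axis p 1) $ k \<le> c $ k + r"
        by simp
    qed
    have x01: "0 \<le> x $ k \<and> x $ k \<le> 1" for k
      using x c[of k] r by (fastforce simp: mem_cube intro: order_trans)
    have y01: "0 \<le> (x + (r / 2) *\<^sub>R axis p 1) $ k \<and> (x + (r / 2) *\<^sub>R axis p 1) $ k \<le> 1" for k
    proof -
      have "x + (r / 2) *\<^sub>R axis p 1 \<in> cube c r" using cu[of "r / 2"] r by auto
      then show ?thesis unfolding mem_cube using c[of k] order_trans by blast
    qed
    have eq: "square_form a (x + t *\<^sub>R axis p 1) = square_form a x + real (a p) ^ 2 * t" for t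
      by (simp add: square_form_add_scaleR square_form_axis)
    have "\<delta> * (r / 2) / (2 * R)
        \<le> measure lborel {t\<in>{0..r / 2}. near_square \<delta> (square_form a x + real (a p) ^ 2 * t)}"
    proof (rule measure_near_square_affine_ge)
      show "0 < real (a p) ^ 2" using ap N by (meson less_le_trans zero_less_power)
      show "0 \<le> square_form a x" unfolding square_form_def by (intro sum_nonneg) (use x01 in auto)
      have "square_form a (x + (r / 2) *\<^sub>R axis p 1) \<le> real CARD('n) * real (16 * N) ^ 2"
        by (rule square_form_le) (use y01 a in auto)
      also have "\<dots> \<le> real CARD('n) * (real CARD('n) * real (16 * N) ^ 2)"
      proof (rule mult_left_mono)
        have "1 * real (16 * N) ^ 2 \<le> real CARD('n) * real (16 * N) ^ 2"
          using n by (rule mult_right_mono) simp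
        then show "real (16 * N) ^ 2 \<le> real CARD('n) * real (16 * N) ^ 2" by simp
      qed simp
      also have "\<dots> = R ^ 2" by (simp add: R_def power2_eq_square)
      finally show "square_form a x + real (a p) ^ 2 * (r / 2) \<le> R ^ 2" by (simp only: eq)
      have "4 * R + 4 \<le> 128 * real CARD('n) * real N"
      proof -
        have "1 \<le> real CARD('n) * real N" using n a[of p] mult_mono[of 1 "real CARD('n)" 1 "real N"] by auto
        then show ?thesis unfolding R_def mult.assoc by linarith
      qed
      also have "\<dots> = (256 * real CARD('n)) * real N / 2" by simp
      also have "\<dots> \<le> (real N * r) * real N / 2"
        using big by (intro divide_right_mono mult_right_mono) auto
      also have "\<dots> = real N ^ 2 * (r / 2)" by (simp add: power2_eq_square)
      also have "\<dots> \<le> real (a p) ^ 2 * (r / 2)" using ap r by (intro mult_right_mono) auto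
      finally show "4 * R + 4 \<le> real (a p) ^ 2 * (r / 2)" .
    qed (use d R r in auto)
    also have "{t\<in>{0..r / 2}. near_square \<delta> (square_form a x + real (a p) ^ 2 * t)}
        = {t\<in>{0..r / 2}. x + t *\<^sub>R axis p 1 \<in> near_set a \<delta> \<inter> cube c r}"
      using cu by (auto simp: near_set_def eq)
    finally show "\<delta> * (r / 2) / (2 * R)
        \<le> measure lborel {t\<in>{0..r / 2}. x + t *\<^sub>R axis p 1 \<in> near_set a \<delta> \<inter> cube c r}" .
  qed (use fmeasurable_lborelD[OF fmeasurable_Int_cube[OF borel_near_set]] fmeasurable_lborelD[OF cube_fmeasurable] r d R in auto)
  moreover have "\<delta> * (r / 2) / (2 * R) / (r / 2) = \<delta> / (32 * real CARD('n) * real N)"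
    using r by (simp add: R_def)
  ultimately show ?thesis by (simp only:)
qed

text \<open>The base points fill a cube of side 2 r, and the condition 2 M <= a_p^2 r lets l r / M
  absorb the additive 2 of the count of squares. The bound M^2 is part of the set rather than a
  property of the cube, since the lemma is also applied to an enlarged cube that may contain points
  where the form is small.\<close>

lemma measure_near_set_cube_le:
  fixes a :: "'n::finite \<Rightarrow> nat"
  assumes r: "r > 0" and d: "0 \<le> \<delta>" "\<delta> \<le> 1" and M: "M \<ge> 2" and big: "2 * M \<le> real (a p) ^ 2 * r"
  shows "measure lborel (near_set a \<delta> \<inter> {x. M ^ 2 \<le> square_form a x} \<inter> cube c r)
     \<le> 4 * \<delta> / M * (2 * r) ^ CARD('n)" (is "measure _ ?S \<le> _")
proof -
  define l where "l = real (a p) ^ 2"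
  have "0 < l * r" using big M unfolding l_def by linarith
  then have l: "l > 0" using r by (simp add: zero_less_mult_iff)
  have lr: "2 \<le> l * r / M" using big M by (simp add: l_def field_simps)
  have "measure lborel ?S \<le> 2 * \<delta> / l * (2 + l * r / M) / r * measure lborel (cube (\<chi> i. c $ i - r) (2 * r))"
  proof (rule measure_le_of_line_slices[where w = "axis p 1"])
    fix x t assume t: "0 \<le> t" "t \<le> r" and "x + t *\<^sub>R axis p 1 \<in> ?S"
    then have h1: "c $ i \<le> x $ i + t * axis p 1 $ i \<and> x $ i + t * axis p 1 $ i \<le> c $ i + r" for i
      by (simp add: mem_cube)
    have h2: "0 \<le> t * axis p 1 $ i \<and> t * axis p 1 $ i \<le> r" for i :: 'n
      using t by (simp add: axis_def)
    show "x \<in> cube (\<chi> i. c $ i - r) (2 * r)"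
      unfolding mem_cube
    proof
      fix i
      show "(\<chi> i. c $ i - r) $ i \<le> x $ i \<and> x $ i \<le> (\<chi> i. c $ i - r) $ i + 2 * r"
        using h1[of i] h2[of i] unfolding vec_lambda_beta by linarith
    qed
  next
    fix x
    have "measure lborel {t\<in>{0..r}. x + t *\<^sub>R axis p 1 \<in> ?S}
        \<le> measure lborel {t\<in>{0..r}. near_square \<delta> (square_form a x + l * t) \<and> M ^ 2 \<le> square_form a x + l * t}"
    proof (rule measure_mono_fmeasurable)
      show "{t\<in>{0..r}. near_square \<delta> (square_form a x + l * t) \<and> M ^ 2 \<le> square_form a x + l * t} \<in> fmeasurable lborel"
        by (rule near_square_affine_slice_ge_fmeasurable[OF l])
      show "{t\<in>{0..r}. x + t *\<^sub>R axis p 1 \<in> ?S} \<in> sets lborel"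
        unfolding sets_lborel
        by (intro borel_line_slice sets.Int borel_near_set borel_square_form_ge borel_cube)
    qed (auto simp: near_set_def square_form_add_scaleR square_form_axis l_def)
    also have "\<dots> \<le> 2 * \<delta> / l * (2 + l * r / M)"
      by (rule measure_near_square_affine_le) (use l d M r in auto)
    finally show "measure lborel {t\<in>{0..r}. x + t *\<^sub>R axis p 1 \<in> ?S} \<le> 2 * \<delta> / l * (2 + l * r / M)" .
  next
    show "?S \<in> sets borel" by (intro sets.Int borel_near_set borel_square_form_ge borel_cube)
  qed (use fmeasurable_lborelD[OF cube_fmeasurable] r d l M in auto)
  also have "measure lborel (cube (\<chi> i. c $ i - r) (2 * r)) = (2 * r) ^ CARD('n)"
    using r by (simp add: measure_cube)
  also have "2 * \<delta> / l * (2 + l * r / M) / r * (2 * r) ^ CARD('n)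
      \<le> 2 * \<delta> / l * (l * r / M + l * r / M) / r * (2 * r) ^ CARD('n)"
    using lr l d r by (intro mult_right_mono divide_right_mono mult_left_mono) auto
  also have "\<dots> = 4 * \<delta> / M * (2 * r) ^ CARD('n)" using l r M by (simp add: field_simps)
  finally show ?thesis .
qed

lemma square_form_ge_on_cube:
  assumes c: "\<And>k. \<eta> ^ 2 \<le> c $ k" and x: "x \<in> cube c r" and b: "m \<le> b i"
  shows "(\<eta> * real m) ^ 2 \<le> square_form b x"
proof -
  have ge: "\<eta> ^ 2 \<le> x $ k" for k using c[of k] x by (auto simp: mem_cube intro: order_trans)
  have x0: "0 \<le> x $ k" for k using ge[of k] zero_le_power2[of \<eta>] by linarith
  have "(\<eta> * real m) ^ 2 = real m ^ 2 * \<eta> ^ 2" by (simp add: power_mult_distrib)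
  also have "\<dots> \<le> real (b i) ^ 2 * x $ i" using ge b x0 by (intro mult_mono power_mono) auto
  also have "\<dots> \<le> square_form b x" using x0 by (rule square_form_ge_component)
  finally show ?thesis .
qed

text \<open>The direction \<^term>\<open>w\<close> of the slices lies in the kernel of \<^term>\<open>square_form a\<close>, so that
  \<^term>\<open>near_set a \<delta>\<close> is a union of lines parallel to \<^term>\<open>w\<close>, while \<^term>\<open>square_form a'\<close> varies
  along \<^term>\<open>w\<close> at a rate proportional to the minor.\<close>

lemma measure_near_set_Int_le:
  fixes a a' :: "'n::finite \<Rightarrow> nat" and i j :: 'n
  assumes ij: "i \<noteq> j" and a: "\<And>k. N < a k \<and> a k \<le> 16 * N" and a': "\<And>k. N' < a' k \<and> a' k \<le> 16 * N'"
    and eta: "\<eta> > 0" and c: "\<And>k. \<eta> ^ 2 \<le> c $ k" and r: "r > 0"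
    and d: "0 \<le> \<delta>" "\<delta> \<le> 1" and d': "0 \<le> \<delta>'" "\<delta>' \<le> 1"
    and N: "\<eta> * real N \<ge> 2" "2 * \<eta> \<le> real N * r" and N': "\<eta> * real N' \<ge> 2"
    and \<omega>: "\<omega> > 0" "real N \<le> \<omega> * \<bar>real (a i) * real (a' j) - real (a j) * real (a' i)\<bar>"
  shows "measure lborel (near_set a \<delta> \<inter> near_set a' \<delta>' \<inter> cube c r)
    \<le> (4 / \<eta> * 6 ^ CARD('n)) * r ^ CARD('n) * (\<delta> / real N) * (\<delta>' / real N') * (131072 * \<omega> / r + 2 / \<eta>)"
    (is "measure _ ?S \<le> _")
proof -
  have Npos: "real N > 0" "real N' > 0" using a[of i] a'[of i] by auto
  have ai: "real N < real (a k)" "real (a k) \<le> 16 * real N" for k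
    using a[of k] by (simp_all flip: of_nat_mult)
  have ai': "real N' < real (a' k)" for k using a'[of k] by simp
  define D where "D = real (a i) * real (a' j) - real (a j) * real (a' i)"
  \<comment> \<open>The sign orients \<open>w\<close> so that the form of a' increases along
    it.\<close>
  define s where "s = sgn D"
  have D: "D \<noteq> 0" using \<omega> Npos by (auto simp: D_def)
  then have s: "\<bar>s\<bar> = 1" "s * D = \<bar>D\<bar>" by (auto simp: s_def sgn_if)
  define w :: "real ^ 'n" where "w = s *\<^sub>R (axis j 1 - (real (a j) / real (a i)) ^ 2 *\<^sub>R axis i 1)"
  define l where "l = square_form a' w"
  have sf: "square_form b w = s * (real (b j) ^ 2 - (real (a j) / real (a i)) ^ 2 * real (b i) ^ 2)" for b
  proof -
    have "w = 0 + s *\<^sub>R axis j 1 + (- s * (real (a j) / real (a i)) ^ 2) *\<^sub>R axis i 1"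
      by (simp add: w_def algebra_simps)
    then have "square_form b w = square_form b 0 + s * real (b j) ^ 2 + (- s * (real (a j) / real (a i)) ^ 2) * real (b i) ^ 2"
      by (simp only: square_form_add_scaleR square_form_axis) (simp add: algebra_simps)
    then show ?thesis by (simp add: square_form_def algebra_simps)
  qed
  have aw: "square_form a w = 0"
    unfolding sf using ai[of i] Npos by (simp add: power_divide)
  have l_ge: "real N' / (128 * \<omega>) \<le> l"
  proof -
    \<comment> \<open>Difference of squares: a_i^2 a'_j^2 - a_j^2 a'_i^2 is the minor
      \<open>D\<close> times a sum that is at least 2 N N'. Dividing by a_i^2, at most (16 N)^2,
      yields the constant 128 = 16^2 / 2.\<close>
    have "l = s * D * (real (a i) * real (a' j) + real (a j) * real (a' i)) / real (a i) ^ 2"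
      unfolding l_def sf D_def using ai[of i] Npos by (simp add: field_simps power2_eq_square)
    also have "\<dots> = \<bar>D\<bar> * (real (a i) * real (a' j) + real (a j) * real (a' i)) / real (a i) ^ 2"
      by (simp add: s)
    also have "\<dots> \<ge> (real N / \<omega>) * (real N * real N' + real N * real N') / (16 * real N) ^ 2"
    proof (intro frac_le mult_mono add_mono power_mono)
      show "real N / \<omega> \<le> \<bar>D\<bar>" using \<omega> by (simp add: D_def field_simps)
      show "0 < real (a i) ^ 2" using ai(1)[of i] Npos by simp
    qed (use ai ai' Npos \<omega> in \<open>auto intro: less_imp_le\<close>)
    finally show ?thesis using Npos \<omega> by (simp add: field_simps power2_eq_square)
  qed
  then have l: "l > 0" using Npos \<omega> by (auto intro: less_le_trans[rotated])
  have wk: "\<bar>w $ k\<bar> \<le> 256" for k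
  proof -
    have "real (a j) / real (a i) \<le> 16 * real N / real N"
      using ai[of i] ai[of j] Npos by (intro frac_le) auto
    then have "(real (a j) / real (a i)) ^ 2 \<le> 16 ^ 2" using Npos by (intro power_mono) auto
    then show ?thesis using ij s by (auto simp: w_def axis_def abs_mult)
  qed
  \<comment> \<open>The entries of \<open>w\<close> are at most 16^2 = 256 in absolute value, so a
    segment of this length moves each coordinate by at most r. This is why the base points lie in a
    cube of side 3 r.\<close>
  define T where "T = r / 256"
  have T: "T > 0" using r by (simp add: T_def)
  let ?c = "(\<chi> k. c $ k - r) :: real ^ 'n"
  let ?Q = "near_set a \<delta> \<inter> {x. (\<eta> * real N) ^ 2 \<le> square_form a x} \<inter> cube ?c (3 * r)"
  have ge: "(\<eta> * real m) ^ 2 \<le> square_form b x" if "x \<in> cube c r" "\<And>k. m < b k" for x m and b :: "'n \<Rightarrow> nat"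
    using square_form_ge_on_cube[OF c that(1), of m b undefined] that(2) by (auto intro: less_imp_le)
  have "measure lborel ?S \<le> 2 * \<delta>' / l * (2 + l * T / (\<eta> * real N')) / T * measure lborel ?Q"
  proof (rule measure_le_of_line_slices[where w = w])
    fix x t assume t: "0 \<le> t" "t \<le> T" and S: "x + t *\<^sub>R w \<in> ?S"
    have eq: "square_form a (x + t *\<^sub>R w) = square_form a x" by (simp add: square_form_add_scaleR aw)
    have "x \<in> cube ?c (3 * r)"
      unfolding mem_cube
    proof
      fix k
      have "\<bar>t * w $ k\<bar> \<le> T * 256" unfolding abs_mult using wk[of k] t T by (intro mult_mono) auto
      then have "\<bar>t * w $ k\<bar> \<le> r" by (simp add: T_def)
      moreover have "c $ k \<le> x $ k + t * w $ k \<and> x $ k + t * w $ k \<le> c $ k + r"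
        using S by (simp add: mem_cube)
      ultimately show "?c $ k \<le> x $ k \<and> x $ k \<le> ?c $ k + 3 * r" by simp linarith
    qed
    then show "x \<in> ?Q" using S ge[of "x + t *\<^sub>R w" N a] a eq by (auto simp: near_set_def)
  next
    fix x
    have "measure lborel {t\<in>{0..T}. x + t *\<^sub>R w \<in> ?S}
        \<le> measure lborel {t\<in>{0..T}. near_square \<delta>' (square_form a' x + l * t) \<and> (\<eta> * real N') ^ 2 \<le> square_form a' x + l * t}"
    proof (rule measure_mono_fmeasurable)
      show "{t\<in>{0..T}. x + t *\<^sub>R w \<in> ?S} \<subseteq> {t\<in>{0..T}. near_square \<delta>' (square_form a' x + l * t) \<and> (\<eta> * real N') ^ 2 \<le> square_form a' x + l * t}"
      proof
        fix t assume "t \<in> {t\<in>{0..T}. x + t *\<^sub>R w \<in> ?S}"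
        then have t: "t \<in> {0..T}" "x + t *\<^sub>R w \<in> near_set a \<delta>" "x + t *\<^sub>R w \<in> near_set a' \<delta>'" "x + t *\<^sub>R w \<in> cube c r"
          by auto
        have "(\<eta> * real N') ^ 2 \<le> square_form a' (x + t *\<^sub>R w)" using ge[OF t(4), of N' a'] a' by auto
        then show "t \<in> {t\<in>{0..T}. near_square \<delta>' (square_form a' x + l * t) \<and> (\<eta> * real N') ^ 2 \<le> square_form a' x + l * t}"
          using t by (auto simp: near_set_def square_form_add_scaleR l_def)
      qed
      show "{t\<in>{0..T}. near_square \<delta>' (square_form a' x + l * t) \<and> (\<eta> * real N') ^ 2 \<le> square_form a' x + l * t} \<in> fmeasurable lborel"
        by (rule near_square_affine_slice_ge_fmeasurable[OF l])
      show "{t\<in>{0..T}. x + t *\<^sub>R w \<in> ?S} \<in> sets lborel"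
        unfolding sets_lborel by (intro borel_line_slice sets.Int borel_near_set borel_cube)
    qed
    also have "\<dots> \<le> 2 * \<delta>' / l * (2 + l * T / (\<eta> * real N'))"
      by (rule measure_near_square_affine_le) (use l d' N' T in auto)
    finally show "measure lborel {t\<in>{0..T}. x + t *\<^sub>R w \<in> ?S} \<le> 2 * \<delta>' / l * (2 + l * T / (\<eta> * real N'))" .
  next
    have "near_set a \<delta> \<inter> {x. (\<eta> * real N) ^ 2 \<le> square_form a x} \<in> sets borel"
      by (intro sets.Int borel_near_set borel_square_form_ge)
    from fmeasurable_lborelD[OF fmeasurable_Int_cube[OF this, of ?c "3 * r"]]
    show "?Q \<in> sets borel" "emeasure lborel ?Q < \<infinity>" by auto
  qed (use T l d' eta Npos in \<open>auto simp: cube_def\<close>)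
  also have "\<dots> \<le> 2 * \<delta>' / l * (2 + l * T / (\<eta> * real N')) / T * (4 * \<delta> / (\<eta> * real N) * (2 * (3 * r)) ^ CARD('n))"
  proof (intro mult_left_mono measure_near_set_cube_le[where p = i])
    have "2 * (\<eta> * real N) = (2 * \<eta>) * real N" by simp
    also have "\<dots> \<le> (real N * r) * real N" using N by (intro mult_right_mono) auto
    also have "\<dots> = real N ^ 2 * r" by (simp add: power2_eq_square)
    also have "\<dots> \<le> real (a i) ^ 2 * (3 * r)" using ai[of i] r by (intro mult_mono power_mono) auto
    finally show "2 * (\<eta> * real N) \<le> real (a i) ^ 2 * (3 * r)" .
  qed (use r d d' N T l eta Npos in auto)
  \<comment> \<open>Here 1024 = 4 * 256 comes from T = r / 256; the bound on 1 / l contributes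
    another 128, and 1024 * 128 = 131072.\<close>
  also have "2 * \<delta>' / l * (2 + l * T / (\<eta> * real N')) / T = 1024 * \<delta>' / r * (1 / l) + 2 * \<delta>' / (\<eta> * real N')"
    using l T r eta Npos by (simp add: field_simps T_def)
  also have "(1024 * \<delta>' / r * (1 / l) + 2 * \<delta>' / (\<eta> * real N'))
      * (4 * \<delta> / (\<eta> * real N) * (2 * (3 * r)) ^ CARD('n))
      \<le> (1024 * \<delta>' / r * (128 * \<omega> / real N') + 2 * \<delta>' / (\<eta> * real N'))
      * (4 * \<delta> / (\<eta> * real N) * (2 * (3 * r)) ^ CARD('n))"
  proof (intro mult_right_mono add_right_mono mult_left_mono)
    show "1 / l \<le> 128 * \<omega> / real N'"
      using l_ge l \<omega> Npos by (simp add: field_simps)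
  qed (use d d' r eta Npos in auto)
  also have "\<dots> = (4 / \<eta> * 6 ^ CARD('n)) * r ^ CARD('n) * (\<delta> / real N) * (\<delta>' / real N') * (131072 * \<omega> / r + 2 / \<eta>)"
    using r eta Npos by (simp add: field_simps power_mult_distrib)
  finally show ?thesis .
qed

subsection \<open>A second moment inequality and a density argument\<close>

text \<open>Cauchy-Schwarz for the counting function f of the family and the indicator of its union
  U. It is derived from the non-negative integral of (f - \<tau> 1_U)^2, for which \<tau> = s / u is
  the minimising choice when u is non-zero; for u = 0 the sum s vanishes as well.\<close>

lemma measure_UN_ge_second_moment:
  fixes A :: "'i \<Rightarrow> 'a set"
  assumes I: "finite I" and A: "\<And>i. i \<in> I \<Longrightarrow> A i \<in> fmeasurable M"
  shows "(\<Sum>i\<in>I. measure M (A i)) ^ 2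
    \<le> (\<Sum>i\<in>I. \<Sum>j\<in>I. measure M (A i \<inter> A j)) * measure M (\<Union>i\<in>I. A i)"
proof -
  let ?U = "\<Union>i\<in>I. A i"
  define s u Q where "s = (\<Sum>i\<in>I. measure M (A i))" and "u = measure M ?U"
    and "Q = (\<Sum>i\<in>I. \<Sum>j\<in>I. measure M (A i \<inter> A j))"
  have U: "?U \<in> fmeasurable M" using I A by (intro fmeasurable.finite_UN) auto
  have AA: "A i \<inter> A j \<in> fmeasurable M" if "i \<in> I" "j \<in> I" for i j
    using A that by (intro fmeasurable_Int_fmeasurable) (auto dest: fmeasurableD)
  have ind: "integrable M (indicator B :: _ \<Rightarrow> real)" "integral\<^sup>L M (indicator B :: _ \<Rightarrow> real) = measure M B"
    if "B \<in> fmeasurable M" for B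
    using that by (auto simp: fmeasurable_def Int_absorb2 sets.sets_into_space intro!: integrable_real_indicator)
  let ?f = "\<lambda>x. \<Sum>i\<in>I. indicator (A i) x :: real"
  have key: "0 \<le> Q - 2 * \<tau> * s + \<tau> ^ 2 * u" for \<tau> :: real
  proof -
    have "0 \<le> integral\<^sup>L M (\<lambda>x. (\<Sum>i\<in>I. \<Sum>j\<in>I. indicator (A i \<inter> A j) x)
        - 2 * \<tau> * ?f x + \<tau> ^ 2 * indicator ?U x)"
    proof (rule integral_nonneg_AE, rule AE_I2)
      fix x
      have "(\<Sum>i\<in>I. \<Sum>j\<in>I. indicator (A i \<inter> A j) x) = ?f x * ?f x"
        by (simp add: sum_product indicator_inter_arith)
      moreover have "?f x * indicator ?U x = ?f x"
      proof (cases "x \<in> ?U")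
        case False
        then have "?f x = 0" by (intro sum.neutral) auto
        then show ?thesis by simp
      qed (simp only: indicator_simps mult_1_right)
      moreover have "indicator ?U x * indicator ?U x = (indicator ?U x :: real)"
        by (cases "x \<in> ?U") (simp_all del: UN_iff)
      moreover have "(?f x - \<tau> * indicator ?U x) ^ 2
        = ?f x * ?f x - 2 * \<tau> * (?f x * indicator ?U x) + \<tau> ^ 2 * (indicator ?U x * indicator ?U x)"
        by (simp only: power2_eq_square) (simp only: algebra_simps)
      ultimately have "(\<Sum>i\<in>I. \<Sum>j\<in>I. indicator (A i \<inter> A j) x) - 2 * \<tau> * ?f x + \<tau> ^ 2 * indicator ?U x
        = (?f x - \<tau> * indicator ?U x) ^ 2" by (simp only:)
      then show "0 \<le> (\<Sum>i\<in>I. \<Sum>j\<in>I. indicator (A i \<inter> A j) x) - 2 * \<tau> * ?f x + \<tau> ^ 2 * indicator ?U x"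
        by (simp only: zero_le_power2)
    qed
    also have "\<dots> = Q - 2 * \<tau> * s + \<tau> ^ 2 * u"
    proof -
      have i1: "integrable M (\<lambda>x. \<Sum>i\<in>I. \<Sum>j\<in>I. indicator (A i \<inter> A j) x :: real)"
        by (intro Bochner_Integration.integrable_sum ind AA)
      have i2: "integrable M ?f" by (intro Bochner_Integration.integrable_sum ind A)
      have "integral\<^sup>L M (\<lambda>x. \<Sum>i\<in>I. \<Sum>j\<in>I. indicator (A i \<inter> A j) x :: real)
          = (\<Sum>i\<in>I. integral\<^sup>L M (\<lambda>x. \<Sum>j\<in>I. indicator (A i \<inter> A j) x :: real))"
        by (intro Bochner_Integration.integral_sum Bochner_Integration.integrable_sum ind AA)
      also have "\<dots> = (\<Sum>i\<in>I. \<Sum>j\<in>I. integral\<^sup>L M (indicator (A i \<inter> A j) :: _ \<Rightarrow> real))"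
        by (intro sum.cong refl Bochner_Integration.integral_sum ind AA)
      also have "\<dots> = Q"
        unfolding Q_def by (intro sum.cong refl ind AA)
      finally have e1: "integral\<^sup>L M (\<lambda>x. \<Sum>i\<in>I. \<Sum>j\<in>I. indicator (A i \<inter> A j) x :: real) = Q" .
      have "integral\<^sup>L M ?f = (\<Sum>i\<in>I. integral\<^sup>L M (indicator (A i) :: _ \<Rightarrow> real))"
        by (intro Bochner_Integration.integral_sum ind A)
      also have "\<dots> = s"
        unfolding s_def by (intro sum.cong refl ind A)
      finally have e2: "integral\<^sup>L M ?f = s" .
      show ?thesis using i1 i2 ind[OF U] by (simp add: e1 e2 u_def)
    qed
    finally show ?thesis .
  qed
  have "s ^ 2 \<le> Q * u"
  proof (cases "u = 0")
    case True
    have "measure M (A i) \<le> u" if "i \<in> I" for i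
      unfolding u_def using that A U by (intro measure_mono_fmeasurable) (auto dest: fmeasurableD)
    then have "s \<le> (\<Sum>i\<in>I. 0)" unfolding s_def by (intro sum_mono) (simp add: True)
    moreover have "0 \<le> s" unfolding s_def by (intro sum_nonneg) simp
    ultimately show ?thesis using True by simp
  next
    case False
    moreover have "0 \<le> u" by (simp add: u_def)
    ultimately have u: "u > 0" by linarith
    have "0 \<le> (Q - 2 * (s / u) * s + (s / u) ^ 2 * u) * u" using key[of "s / u"] u by simp
    also have "\<dots> = Q * u - s ^ 2" using u by (simp add: field_simps power2_eq_square)
    finally show ?thesis by simp
  qed
  then show ?thesis by (simp only: s_def u_def Q_def)
qed

text \<open>Let E be the part of the large cube missed by \<open>W\<close>. Almost all of E is
  covered by non-overlapping dyadic cubes inside an open U whose measure exceeds that of E by less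
  than e. In each cube E misses a proportion \<kappa>, so |E| <= (1 - \<kappa>) (|E| + e), which for
  small e forces |E| = 0.\<close>

lemma emeasure_Diff_eq_0_of_cubes:
  fixes W :: "(real ^ 'n::finite) set"
  assumes W: "W \<in> sets borel" and \<kappa>: "0 < \<kappa>" "\<kappa> \<le> 1" and \<alpha>: "\<alpha> < \<beta>"
    and dens: "\<And>c r. r > 0 \<Longrightarrow> (\<And>i. \<alpha> \<le> c $ i \<and> c $ i + r \<le> \<beta>)
      \<Longrightarrow> \<kappa> * r ^ CARD('n) \<le> measure lborel (W \<inter> cube c r)"
  shows "emeasure lborel (cbox (\<chi> i. \<alpha>) (\<chi> i. \<beta>) - W) = 0"
proof -
  define a b :: "real ^ 'n" where "a = (\<chi> i. \<alpha>)" and "b = (\<chi> i. \<beta>)"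
  let ?E = "cbox a b - W"
  have E: "?E \<in> sets borel" using W by auto
  have Efm: "?E \<in> fmeasurable lborel"
    by (rule fmeasurableI2[of "cbox a b"]) (use E in auto)
  have small: "measure lborel ?E \<le> (1 - \<kappa>) * (measure lborel ?E + e)" if e: "e > 0" for e
  proof -
    obtain U where U: "open U" "?E \<subseteq> U" "emeasure lborel (U - ?E) < ennreal e"
      using outer_regular_lborel[OF E e] .
    \<comment> \<open>Each box of the covering has a tag in E, and E lies in U, so the gauge forces
      the box into U. The value UNIV only completes the gauge off U.\<close>
    have g: "gauge (\<lambda>x. if x \<in> U then U else UNIV)" using U by (auto simp: gauge_def)
    have ne: "box a b \<noteq> {}" using \<alpha> by (auto simp: a_def b_def interval_ne_empty_cart)
    have Esub: "?E \<subseteq> cbox a b" by auto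
    obtain D where D: "countable D" "\<Union>D \<subseteq> cbox a b"
      "\<And>K. K \<in> D \<Longrightarrow> interior K \<noteq> {} \<and> (\<exists>c d. K = cbox c d)"
      "pairwise (\<lambda>A B. interior A \<inter> interior B = {}) D"
      "\<And>K. K \<in> D \<Longrightarrow> \<exists>x \<in> ?E \<inter> K. K \<subseteq> (if x \<in> U then U else UNIV)"
      "\<And>u v. cbox u v \<in> D \<Longrightarrow> \<exists>n. \<forall>i \<in> Basis. v \<bullet> i - u \<bullet> i = (b \<bullet> i - a \<bullet> i) / 2^n"
      "?E \<subseteq> \<Union>D"
      by (rule covering_lemma[OF Esub ne g]) (rule that, assumption, (assumption | blast)+)
    \<comment> \<open>The boxes have side lengths (b_i - a_i) / 2^n. The ambient box is a cube, so
      these are equal in all directions and \<open>dens\<close> applies.\<close>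
    have cubeD: "\<exists>c r. K = cube c r \<and> r > 0 \<and> (\<forall>i. \<alpha> \<le> c $ i \<and> c $ i + r \<le> \<beta>)" if K: "K \<in> D" for K
    proof -
      obtain c d where cd: "K = cbox c d" using D(3)[OF K] by auto
      obtain n :: nat where n: "\<And>i. i \<in> Basis \<Longrightarrow> d \<bullet> i - c \<bullet> i = (b \<bullet> i - a \<bullet> i) / 2^n"
        using D(6)[of c d] K cd by blast
      define r where "r = (\<beta> - \<alpha>) / 2 ^ n"
      have r: "r > 0" using \<alpha> by (simp add: r_def)
      have d: "d $ i = c $ i + r" for i
      proof -
        have "axis i (1 :: real) \<in> (Basis :: (real ^ 'n) set)" by simp
        from n[OF this] have "d $ i - c $ i = (b $ i - a $ i) / 2 ^ n"
          by (simp only: cart_eq_inner_axis[symmetric])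
        then have "d $ i - c $ i = r" by (simp add: r_def a_def b_def)
        then show ?thesis by simp
      qed
      then have "d = (\<chi> i. c $ i + r)" by (simp add: vec_eq_iff)
      then have "K = cube c r" unfolding cd cube_def by (simp only:)
      moreover have "c \<in> K" "d \<in> K" unfolding cd using d r by (auto simp: mem_box_cart)
      then have "c \<in> cbox a b" "d \<in> cbox a b" using D(2) K by auto
      then have "\<forall>i. \<alpha> \<le> c $ i \<and> c $ i + r \<le> \<beta>" using d by (auto simp: mem_box_cart a_def b_def)
      ultimately show ?thesis using r by blast
    qed
    have KU: "K \<subseteq> U" if "K \<in> D" for K using D(5)[OF that] U(2) by (auto split: if_splits)
    let ?I = "\<Union>K\<in>D. interior K"
    \<comment> \<open>The closed cubes may share faces, so measures are added over the disjoint
      interiors; the faces form a null set.\<close>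
    have null: "?E - ?I \<in> null_sets lborel"
    proof (rule null_sets_subset)
      have "K - interior K \<in> null_sets lborel" if K: "K \<in> D" for K
      proof -
        obtain c d where "K = cbox c d" using D(3)[OF K] by auto
        then show ?thesis
          using negligible_frontier_interval[of c d]
          by (simp add: negligible_iff_null_sets null_sets_completion_iff interior_cbox)
      qed
      then show "(\<Union>K\<in>D. K - interior K) \<in> null_sets lborel"
        using D(1) by (intro null_sets_UN') auto
      show "?E - ?I \<subseteq> (\<Union>K\<in>D. K - interior K)" using D(7) by blast
      have "open ?I" by auto
      then show "?E - ?I \<in> sets lborel" using E by auto
    qed
    have Kle: "emeasure lborel (?E \<inter> interior K) \<le> ennreal (1 - \<kappa>) * emeasure lborel (interior K)"
      if K: "K \<in> D" for K
    proof -
      obtain c r where cr: "K = cube c r" "r > 0" "\<And>i. \<alpha> \<le> c $ i \<and> c $ i + r \<le> \<beta>"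
        using cubeD[OF K] by auto
      have "measure lborel (interior K) = measure lborel K"
        by (simp add: cr(1) cube_def interior_cbox measure_lborel_box_eq measure_lborel_cbox_eq)
      also have "\<dots> = r ^ CARD('n)" using cr by (simp add: measure_cube)
      finally have mi: "measure lborel (interior K) = r ^ CARD('n)" .
      have ifm: "interior K \<in> fmeasurable lborel"
        unfolding cr(1) cube_def interior_cbox by simp
      have "measure lborel (?E \<inter> interior K) \<le> measure lborel (K - W \<inter> K)"
      proof (rule measure_mono_fmeasurable)
        show "?E \<inter> interior K \<subseteq> K - W \<inter> K" using interior_subset by auto
        show "?E \<inter> interior K \<in> sets lborel" using E by auto
        show "K - W \<inter> K \<in> fmeasurable lborel"
          using cube_fmeasurable[of c r] W cr(1) borel_cube[of c r] by (intro fmeasurable_Diff) auto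
      qed
      also have "\<dots> = measure lborel K - measure lborel (W \<inter> K)"
        using cube_fmeasurable[of c r] W cr(1) borel_cube[of c r]
        by (intro measure_Diff) (auto simp: fmeasurable_def less_top)
      also have "\<dots> \<le> r ^ CARD('n) - \<kappa> * r ^ CARD('n)"
        using dens[OF cr(2,3)] cr by (simp add: measure_cube)
      also have "\<dots> = (1 - \<kappa>) * measure lborel (interior K)" by (simp add: mi algebra_simps)
      finally have le: "measure lborel (?E \<inter> interior K) \<le> (1 - \<kappa>) * measure lborel (interior K)" .
      have "?E \<inter> interior K \<in> fmeasurable lborel"
        using fmeasurable_Int_fmeasurable[OF Efm] by simp
      then show ?thesis
        using le ifm \<kappa> by (simp add: emeasure_eq_measure2 ennreal_mult[symmetric] ennreal_leI)
    qed
    have disj: "disjoint_family_on interior D"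
      using D(4) by (auto simp: disjoint_family_on_def pairwise_def)
    have "emeasure lborel ?E = emeasure lborel (?E \<inter> ?I)"
    proof -
      have "open ?I" by auto
      then have "?E \<inter> ?I \<in> sets lborel" using E by auto
      then have "emeasure lborel ((?E \<inter> ?I) \<union> (?E - ?I)) = emeasure lborel (?E \<inter> ?I)"
        using null by (rule emeasure_Un_null_set)
      then show ?thesis by (simp add: Int_Diff_Un)
    qed
    also have "?E \<inter> ?I = (\<Union>K\<in>D. ?E \<inter> interior K)" by blast
    also have "emeasure lborel \<dots> = (\<integral>\<^sup>+K. emeasure lborel (?E \<inter> interior K) \<partial>count_space D)"
      using E D(1) disj by (intro emeasure_UN_countable) (auto simp: disjoint_family_on_def)
    also have "\<dots> \<le> (\<integral>\<^sup>+K. ennreal (1 - \<kappa>) * emeasure lborel (interior K) \<partial>count_space D)"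
      using Kle by (intro nn_integral_mono) auto
    also have "\<dots> = ennreal (1 - \<kappa>) * (\<integral>\<^sup>+K. emeasure lborel (interior K) \<partial>count_space D)"
      by (intro nn_integral_cmult) auto
    also have "(\<integral>\<^sup>+K. emeasure lborel (interior K) \<partial>count_space D) = emeasure lborel ?I"
      using D(1) disj by (intro emeasure_UN_countable[symmetric]) auto
    also have "\<dots> \<le> emeasure lborel U"
      using KU interior_subset U(1) by (intro emeasure_mono UN_least) (blast, simp)
    also have "emeasure lborel U = emeasure lborel (?E \<union> (U - ?E))"
      using U(2) by (intro arg_cong[where f="emeasure lborel"]) auto
    also have "\<dots> \<le> emeasure lborel ?E + emeasure lborel (U - ?E)"
      using E U(1) by (intro emeasure_subadditive) auto
    also have "\<dots> \<le> emeasure lborel ?E + ennreal e"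
      using U(3) by (intro add_left_mono) auto
    also have "\<dots> = ennreal (measure lborel ?E + e)"
      using Efm e by (simp add: emeasure_eq_measure2)
    finally have "emeasure lborel ?E \<le> ennreal (1 - \<kappa>) * ennreal (measure lborel ?E + e)"
      by (simp add: mult_left_mono)
    then have "ennreal (measure lborel ?E) \<le> ennreal ((1 - \<kappa>) * (measure lborel ?E + e))"
      using Efm \<kappa> e by (simp add: emeasure_eq_measure2 ennreal_mult)
    then show ?thesis using \<kappa> e by (subst (asm) ennreal_le_iff) auto
  qed
  have "measure lborel ?E = 0"
  proof (rule ccontr)
    assume "measure lborel ?E \<noteq> 0"
    then have m: "measure lborel ?E > 0" using measure_nonneg[of lborel ?E] by linarith
    \<comment> \<open>With e = \<kappa> |E| the factor becomes (1 - \<kappa>) (1 + \<kappa>) = 1 -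
      \<kappa>^2, which is below 1.\<close>
    have "measure lborel ?E \<le> (1 - \<kappa>) * (measure lborel ?E + \<kappa> * measure lborel ?E)"
      using m \<kappa> by (intro small) auto
    also have "\<dots> = measure lborel ?E - \<kappa> ^ 2 * measure lborel ?E"
      by (simp add: algebra_simps power2_eq_square)
    finally have "\<kappa> ^ 2 * measure lborel ?E \<le> 0" by simp
    moreover have "0 < \<kappa> ^ 2 * measure lborel ?E" using m \<kappa> by auto
    ultimately show False by linarith
  qed
  then show ?thesis using Efm by (simp add: emeasure_eq_measure2 a_def b_def)
qed

subsection \<open>The convergence case\<close>

text \<open>Infinitely many indices means an index outside every finite set, and a countable type
  has only countably many finite subsets.\<close>

lemma borel_infinitely_often:
  fixes B :: "'i::countable \<Rightarrow> 'a::topological_space set"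
  assumes "\<And>i. B i \<in> sets borel"
  shows "{x. infinite {i. x \<in> B i}} \<in> sets borel"
proof -
  have "{x. infinite {i. x \<in> B i}} = (\<Inter>F\<in>Collect finite. \<Union>i\<in>-F. B i)"
  proof (intro equalityI subsetI)
    fix x assume x: "x \<in> {x. infinite {i. x \<in> B i}}"
    show "x \<in> (\<Inter>F\<in>Collect finite. \<Union>i\<in>-F. B i)"
    proof clarify
      fix F :: "'i set" assume "finite F"
      then have "\<not> {i. x \<in> B i} \<subseteq> F" using x finite_subset by auto
      then show "x \<in> (\<Union>i\<in>-F. B i)" by auto
    qed
  next
    fix x assume x: "x \<in> (\<Inter>F\<in>Collect finite. \<Union>i\<in>-F. B i)"
    show "x \<in> {x. infinite {i. x \<in> B i}}"
    proof clarify
      assume "finite {i. x \<in> B i}"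
      then show False using x by auto
    qed
  qed
  also have "\<dots> \<in> sets borel"
    using assms by (intro sets.countable_INT'' sets.countable_UN' countable_Collect_finite) auto
  finally show ?thesis .
qed

lemma borel_W: "(W \<psi> :: (real ^ 'n::finite) set) \<in> sets borel"
proof -
  let ?B = "\<lambda>i. if fst i \<noteq> (\<lambda>_. 0) then {x. \<bar>square_form (fst i) x - real (snd i) ^ 2\<bar> < \<psi> (real (height (fst i)))} else {}"
  have eq: "{(a, b). a \<noteq> (\<lambda>_. 0) \<and> \<bar>(\<Sum>i\<in>UNIV. real (a i) ^ 2 * x $ i) - real b ^ 2\<bar> < \<psi> (real (height a))}
      = {i. x \<in> ?B i}" for x
    by (auto simp: square_form_def)
  have "(W \<psi> :: (real ^ 'n) set) = cbox 0 1 \<inter> {x. infinite {i. x \<in> ?B i}}"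
    unfolding W_def eq by blast
  moreover have "?B i \<in> sets borel" for i
    by (auto intro!: borel_open open_Collect_less continuous_intros continuous_on_square_form)
  then have "{x. infinite {i. x \<in> ?B i}} \<in> sets borel" by (rule borel_infinitely_often)
  then have "cbox 0 1 \<inter> {x. infinite {i. x \<in> ?B i}} \<in> sets borel" by (rule sets.Int[rotated]) simp
  ultimately show ?thesis by (simp only:)
qed

text \<open>A single vector thus accounts for finitely many solutions; together with
  \<open>finite_height_le\<close>, infinitely many solutions force unbounded heights.\<close>

lemma finite_squares_near: "finite {b::nat. \<bar>y - real b ^ 2\<bar> < d}"
proof (rule finite_subset)
  show "{b::nat. \<bar>y - real b ^ 2\<bar> < d} \<subseteq> {..nat \<lceil>y + d\<rceil>}"
  proof clarsimp
    fix b :: nat assume b: "\<bar>y - (real b)\<^sup>2\<bar> < d"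
    have "b * 1 \<le> b * b" by (cases "b = 0") auto
    then have "real b \<le> real b ^ 2" unfolding power2_eq_square by (simp flip: of_nat_mult)
    then have "real b \<le> y + d" using b by linarith
    then show "b \<le> nat \<lceil>y + d\<rceil>" by linarith
  qed
qed simp

lemma finite_height_le: "finite {a :: 'n::finite \<Rightarrow> nat. height a \<le> m}"
  by (rule finite_subset[of _ "PiE UNIV (\<lambda>_. {0..m})"]) (auto simp: height_def intro: finite_PiE)

text \<open>Some coordinate attains the height, which gives n choices, and each of the others has h
  + 1 values.\<close>

lemma card_height_eq_le:
  "real (card {a :: 'n::finite \<Rightarrow> nat. height a = h}) \<le> real CARD('n) * real (h + 1) ^ (CARD('n) - 1)"
proof -
  let ?P = "\<lambda>i. PiE (UNIV :: 'n set) (\<lambda>j. if j = i then {h} else {0..h})"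
  have sub: "{a :: 'n \<Rightarrow> nat. height a = h} \<subseteq> (\<Union>i\<in>UNIV. ?P i)"
  proof
    fix a :: "'n \<Rightarrow> nat" assume "a \<in> {a. height a = h}"
    then have h: "Max (range a) = h" by (simp add: height_def)
    then obtain i where "a i = h" using Max_in[of "range a"] by auto
    moreover have "a j \<le> h" for j using h by (metis Max_ge finite finite_imageI rangeI)
    ultimately have "a \<in> ?P i" by auto
    then show "a \<in> (\<Union>i\<in>UNIV. ?P i)" by blast
  qed
  have cP: "card (?P i) = (h + 1) ^ (CARD('n) - 1)" for i
  proof -
    have "card (?P i) = (\<Prod>j\<in>UNIV. card (if j = i then {h} else {0..h}))" by (simp add: card_PiE)
    also have "\<dots> = (\<Prod>j\<in>UNIV - {i}. card (if j = i then {h} else {0..h}))"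
      by (subst prod.remove[of _ i]) auto
    also have "\<dots> = (\<Prod>j\<in>UNIV - {i}. h + 1)" by (intro prod.cong) auto
    also have "\<dots> = (h + 1) ^ (CARD('n) - 1)" by (simp add: card_Diff_singleton)
    finally show ?thesis .
  qed
  have "card {a :: 'n \<Rightarrow> nat. height a = h} \<le> card (\<Union>i\<in>UNIV. ?P i)"
    using sub by (rule card_mono[rotated]) (auto intro: finite_PiE)
  also have "\<dots> \<le> (\<Sum>i\<in>UNIV. card (?P i))" by (rule card_UN_le) simp
  also have "\<dots> = CARD('n) * (h + 1) ^ (CARD('n) - 1)" by (simp only: cP) simp
  finally have "real (card {a :: 'n \<Rightarrow> nat. height a = h}) \<le> real (CARD('n) * (h + 1) ^ (CARD('n) - 1))"
    by (subst of_nat_le_iff)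
  then show ?thesis by simp
qed

lemma measure_near_set_unit_cube_le:
  fixes a :: "'n::finite \<Rightarrow> nat"
  assumes h: "height a = h" "h \<ge> 1" and d: "0 \<le> \<delta>" "\<delta> \<le> 1"
  shows "measure lborel (near_set a \<delta> \<inter> cube 0 1) \<le> 6 * real CARD('n) * 2 ^ CARD('n) * \<delta> / real h"
proof -
  obtain p where p: "a p = h" using h Max_in[of "range a"] unfolding height_def by auto
  have ah: "a k \<le> h" for k using h unfolding height_def by (metis Max_ge finite finite_imageI rangeI)
  have n: "real CARD('n) \<ge> 1" by (simp add: Suc_le_eq)
  let ?B = "\<lambda>b::nat. {x. \<bar>square_form a x - real b ^ 2\<bar> < \<delta>} \<inter> cube 0 1"
  \<comment> \<open>The form is at most n h^2, hence at most (n h)^2, so a square within distance 1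
    of it has root at most n h + 1.\<close>
  let ?J = "{0..CARD('n) * h + 1}"
  have Bm: "?B b \<in> fmeasurable lborel" for b
    by (intro fmeasurable_Int_cube borel_open open_Collect_less continuous_intros continuous_on_square_form)
  have Bb: "?B b \<in> sets borel" for b using fmeasurable_lborelD(1)[OF Bm] .
  have Ble: "measure lborel (?B b) \<le> 2 * \<delta> / real h ^ 2 * 2 ^ CARD('n)" for b
  proof -
    have "measure lborel (?B b) \<le> 2 * \<delta> / real h ^ 2 / 1 * measure lborel (cube (\<chi> i. - 1) 2 :: (real ^ 'n) set)"
    proof (rule measure_le_of_line_slices[where w = "axis p 1"])
      fix x t assume t: "0 \<le> t" "t \<le> 1" "x + t *\<^sub>R axis p 1 \<in> ?B b"
      show "x \<in> cube (\<chi> i. - 1) 2" unfolding mem_cube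
      proof
        fix i
        have "0 \<le> t * axis p 1 $ i \<and> t * axis p 1 $ i \<le> 1" using t by (simp add: axis_def)
        moreover have "0 \<le> x $ i + t * axis p 1 $ i \<and> x $ i + t * axis p 1 $ i \<le> 1"
          using t by (simp add: mem_cube)
        ultimately show "(\<chi> i. - 1) $ i \<le> x $ i \<and> x $ i \<le> (\<chi> i. - 1) $ i + 2"
          unfolding vec_lambda_beta by linarith
      qed
    next
      fix x
      have hp: "real h ^ 2 > 0" using h by simp
      have "measure lborel {t\<in>{0..1}. x + t *\<^sub>R axis p 1 \<in> ?B b}
        \<le> measure lborel {t. \<bar>square_form a x + real h ^ 2 * t - real b ^ 2\<bar> < \<delta>}"
      proof (rule measure_mono_fmeasurable)
        show "{t\<in>{0..1}. x + t *\<^sub>R axis p 1 \<in> ?B b} \<in> sets lborel"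
          unfolding sets_lborel by (rule borel_line_slice[OF Bb])
      qed (auto simp: square_form_add_scaleR square_form_axis p near_point_affine_fmeasurable[OF hp])
      also have "\<dots> = 2 * \<delta> / real h ^ 2" by (rule measure_near_point_affine[OF hp d(1)])
      finally show "measure lborel {t\<in>{0..1}. x + t *\<^sub>R axis p 1 \<in> ?B b} \<le> 2 * \<delta> / real h ^ 2" .
    qed (use Bb fmeasurable_lborelD[OF cube_fmeasurable] d in auto)
    then show ?thesis by (simp add: measure_cube)
  qed
  have sub: "near_set a \<delta> \<inter> cube 0 1 \<subseteq> (\<Union>b\<in>?J. ?B b)"
  proof
    fix x assume x: "x \<in> near_set a \<delta> \<inter> cube 0 1"
    then obtain b :: nat where b: "\<bar>square_form a x - real b ^ 2\<bar> < \<delta>"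
      by (auto simp: near_set_def near_square_def)
    have "square_form a x \<le> real CARD('n) * real h ^ 2"
      by (rule square_form_le) (use x ah in \<open>auto simp: mem_cube\<close>)
    also have "\<dots> \<le> real CARD('n) * (real CARD('n) * real h ^ 2)"
      using n mult_right_mono[OF n, of "real h ^ 2"] by (intro mult_left_mono) auto
    also have "\<dots> = (real CARD('n) * real h) ^ 2" by (simp add: power2_eq_square)
    finally have "real b ^ 2 \<le> (real CARD('n) * real h) ^ 2 + 1" using b d by linarith
    also have "\<dots> \<le> (real CARD('n) * real h + 1) ^ 2" by (simp add: power2_eq_square algebra_simps)
    finally have "real b \<le> real CARD('n) * real h + 1" by (rule power2_le_imp_le) simp
    then have "real b \<le> real (CARD('n) * h + 1)" by simp
    then have "b \<in> ?J" by (simp only: of_nat_le_iff) simp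
    then show "x \<in> (\<Union>b\<in>?J. ?B b)" using b x by blast
  qed
  have "measure lborel (near_set a \<delta> \<inter> cube 0 1) \<le> measure lborel (\<Union>b\<in>?J. ?B b)"
  proof (rule measure_mono_fmeasurable[OF sub])
    show "(\<Union>b\<in>?J. ?B b) \<in> fmeasurable lborel" using Bm by (intro fmeasurable.finite_UN) auto
  qed (simp add: borel_near_set borel_cube sets.Int)
  also have "\<dots> \<le> (\<Sum>b\<in>?J. measure lborel (?B b))" using Bb by (intro measure_UNION_le) auto
  also have "\<dots> \<le> (\<Sum>b\<in>?J. 2 * \<delta> / real h ^ 2 * 2 ^ CARD('n))" by (intro sum_mono Ble)
  also have "\<dots> = (real CARD('n) * real h + 2) * (2 * \<delta> / real h ^ 2 * 2 ^ CARD('n))"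
    by (simp only: sum_constant card_atLeastAtMost) simp
  also have "\<dots> \<le> (3 * real CARD('n) * real h) * (2 * \<delta> / real h ^ 2 * 2 ^ CARD('n))"
  proof (rule mult_right_mono)
    have "1 * 1 \<le> real CARD('n) * real h" using n h by (intro mult_mono) auto
    then show "real CARD('n) * real h + 2 \<le> 3 * real CARD('n) * real h" unfolding mult.assoc by linarith
  qed (use d in auto)
  also have "\<dots> = 6 * real CARD('n) * 2 ^ CARD('n) * \<delta> / real h"
    using h by (simp add: power2_eq_square field_simps)
  finally show ?thesis .
qed

text \<open>Height h contributes O(h^(n-1)) vectors with sets of measure O(\<psi>(h) / h), so the
  series to which Borel--Cantelli is applied is dominated by the given one.\<close>

lemma emeasure_W_eq_0:
  fixes \<psi> :: "real \<Rightarrow> real"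
  assumes n2: "CARD('n::finite) \<ge> 2"
    and pos: "\<And>h. h > 0 \<Longrightarrow> \<psi> h > 0"
    and lim: "(\<psi> \<longlongrightarrow> 0) at_top"
    and sum: "summable (\<lambda>h. real (Suc h) ^ (CARD('n) - 2) * \<psi> (real (Suc h)))"
  shows "emeasure lborel (W \<psi> :: (real ^ 'n) set) = 0"
proof -
  let ?n = "CARD('n)"
  \<comment> \<open>The index is shifted because height 0 belongs to the zero vector alone, which
    \<open>W\<close> excludes.\<close>
  define E where "E k = (\<Union>a\<in>{a :: 'n \<Rightarrow> nat. height a = Suc k}. near_set a (\<psi> (real (Suc k))) \<inter> cube 0 1)" for k
  have fin: "finite {a :: 'n \<Rightarrow> nat. height a = h}" for h
    by (rule finite_subset[OF _ finite_height_le[of h]]) auto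
  have Efm: "E k \<in> fmeasurable lborel" for k
    unfolding E_def by (intro fmeasurable.finite_UN fin fmeasurable_Int_cube borel_near_set)
  define C where "C = real ?n * 2 ^ (?n - 1) * (6 * real ?n * 2 ^ ?n)"
  have E_le: "measure lborel (E k) \<le> C * (real (Suc k) ^ (?n - 2) * \<psi> (real (Suc k)))"
    if le1: "\<psi> (real (Suc k)) \<le> 1" for k
  proof -
    define h where "h = real (Suc k)"
    have h: "h \<ge> 1" by (simp add: h_def)
    have "measure lborel (E k) \<le> (\<Sum>a | height a = Suc k. measure lborel (near_set (a :: 'n \<Rightarrow> nat) (\<psi> h) \<inter> cube 0 1))"
      unfolding E_def h_def by (intro measure_UNION_le fin) (auto intro: borel_near_set borel_cube)
    also have "\<dots> \<le> (\<Sum>a | height (a :: 'n \<Rightarrow> nat) = Suc k. 6 * real ?n * 2 ^ ?n * \<psi> h / real (Suc k))"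
      using le1 pos[of h] h by (intro sum_mono measure_near_set_unit_cube_le) (auto simp: h_def)
    also have "\<dots> = real (card {a :: 'n \<Rightarrow> nat. height a = Suc k}) * (6 * real ?n * 2 ^ ?n * \<psi> h / h)"
      by (simp add: h_def)
    also have "\<dots> \<le> (real ?n * (2 * h) ^ (?n - 1)) * (6 * real ?n * 2 ^ ?n * \<psi> h / h)"
    proof (rule mult_right_mono)
      have "real (card {a :: 'n \<Rightarrow> nat. height a = Suc k}) \<le> real ?n * real (Suc k + 1) ^ (?n - 1)"
        by (rule card_height_eq_le)
      also have "\<dots> \<le> real ?n * (2 * h) ^ (?n - 1)"
        by (intro mult_left_mono power_mono) (auto simp: h_def)
      finally show "real (card {a :: 'n \<Rightarrow> nat. height a = Suc k}) \<le> real ?n * (2 * h) ^ (?n - 1)" .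
    qed (use pos[of h] h in auto)
    also have "\<dots> = C * (h ^ (?n - 1) / h * \<psi> h)"
      by (simp add: C_def power_mult_distrib)
    also have "h ^ (?n - 1) / h = h ^ (?n - 2)"
    proof -
      have "?n - 1 = Suc (?n - 2)" using n2 by simp
      then show ?thesis using h by simp
    qed
    finally show ?thesis by (simp only: h_def)
  qed
  have "((\<lambda>k. \<psi> (real (Suc k))) \<longlongrightarrow> 0) sequentially"
    by (rule filterlim_compose[OF lim]) (rule filterlim_compose[OF filterlim_real_sequentially filterlim_Suc])
  then have "\<forall>\<^sub>F k in sequentially. \<psi> (real (Suc k)) < 1" by (rule order_tendstoD) simp
  then have "\<forall>\<^sub>F k in sequentially. norm (measure lborel (E k)) \<le> C * (real (Suc k) ^ (?n - 2) * \<psi> (real (Suc k)))"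
    by eventually_elim (use E_le in auto)
  then have "summable (\<lambda>k. measure lborel (E k))"
    by (rule summable_comparison_test_ev) (rule summable_mult[OF sum])
  then have ae: "AE x in lborel. \<forall>\<^sub>F k in sequentially. x \<in> space lborel - E k"
    using fmeasurable_lborelD[OF Efm] by (intro borel_cantelli_AE1) auto
  have notW: "x \<notin> W \<psi>" if ev: "\<forall>\<^sub>F k in sequentially. x \<in> space lborel - E k" for x
  proof
    assume x: "x \<in> W \<psi>"
    obtain m where m: "\<And>k. k \<ge> m \<Longrightarrow> x \<notin> E k" using ev by (auto simp: eventually_sequentially)
    have x01: "x \<in> cube 0 1"
    proof -
      have "x \<in> cbox 0 1" using x by (simp add: W_def)
      then show ?thesis by (simp add: mem_cube mem_box_cart)
    qed
    have "{(a :: 'n \<Rightarrow> nat, b :: nat). a \<noteq> (\<lambda>_. 0) \<and> \<bar>(\<Sum>i\<in>UNIV. real (a i) ^ 2 * x $ i) - real b ^ 2\<bar> < \<psi> (real (height a))}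
      \<subseteq> Sigma {a. height a \<le> m} (\<lambda>a. {b. \<bar>square_form a x - real b ^ 2\<bar> < \<psi> (real (height a))})"
    proof clarsimp
      fix a :: "'n \<Rightarrow> nat" and b :: nat
      assume a: "a \<noteq> (\<lambda>_. 0)" and b: "\<bar>(\<Sum>i\<in>UNIV. (real (a i))\<^sup>2 * x $ i) - (real b)\<^sup>2\<bar> < \<psi> (real (height a))"
      have b': "\<bar>square_form a x - real b ^ 2\<bar> < \<psi> (real (height a))"
        using b by (simp add: square_form_def)
      have "height a \<le> m"
      proof (rule ccontr)
        assume "\<not> height a \<le> m"
        then obtain k where k: "height a = Suc k" "k \<ge> m" by (cases "height a") auto
        have "x \<in> E k" unfolding E_def
          using b' x01 k by (auto simp: near_set_def near_square_def)
        then show False using m k by auto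
      qed
      then show "height a \<le> m \<and> \<bar>square_form a x - (real b)\<^sup>2\<bar> < \<psi> (real (height a))" using b' by simp
    qed
    moreover have "finite (Sigma {a :: 'n \<Rightarrow> nat. height a \<le> m} (\<lambda>a. {b. \<bar>square_form a x - real b ^ 2\<bar> < \<psi> (real (height a))}))"
      by (intro finite_SigmaI finite_height_le finite_squares_near)
    ultimately have "finite {(a :: 'n \<Rightarrow> nat, b :: nat). a \<noteq> (\<lambda>_. 0) \<and> \<bar>(\<Sum>i\<in>UNIV. real (a i) ^ 2 * x $ i) - real b ^ 2\<bar> < \<psi> (real (height a))}"
      by (rule finite_subset)
    then show False using x by (simp add: W_def)
  qed
  have "AE x in lborel. x \<notin> (W \<psi> :: (real ^ 'n) set)" by (rule eventually_mono[OF ae notW])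
  then show ?thesis using borel_W[of \<psi>]
    by (subst (asm) AE_iff_measurable[of "W \<psi>"]) auto
qed

subsection \<open>The divergence case\<close>

text \<open>This selects the minor for \<open>measure_near_set_Int_le\<close>: coordinates
  \<open>p\<close> and \<open>q\<close> if their determinant is non-zero, otherwise \<open>p\<close>
  and some k with a_k different from a'_k. In the latter case the (p, q) entries agree and the minor
  is a_p (a'_k - a_k).\<close>

lemma measure_near_set_block_le:
  fixes p q :: "'n::finite"
  assumes pq: "p \<noteq> q" and a: "a \<in> vector_block p q N" and a': "a' \<in> vector_block p q N'" and ne: "a \<noteq> a'"
    and eta: "\<eta> > 0" and c: "\<And>k. \<eta> ^ 2 \<le> c $ k" and r: "r > 0"
    and d: "0 \<le> \<delta>" "\<delta> \<le> 1" and d': "0 \<le> \<delta>'" "\<delta>' \<le> 1"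
    and N: "1 \<le> N" "N \<le> N'" "\<eta> * real N \<ge> 2" "2 * \<eta> \<le> real N * r"
  shows "measure lborel (near_set a \<delta> \<inter> near_set a' \<delta>' \<inter> cube c r)
    \<le> (4 / \<eta> * 6 ^ CARD('n)) * r ^ CARD('n) * (\<delta> / real N) * (\<delta>' / real N')
      * (131072 * det_weight N (a p, a q) (a' p, a' q) / r + 2 / \<eta>)"
proof -
  have ab: "\<And>k. N < a k \<and> a k \<le> 16 * N" "coprime (a p) (a q)"
    and ab': "\<And>k. N' < a' k \<and> a' k \<le> 16 * N'" "coprime (a' p) (a' q)"
    using a a' by (auto simp: vector_block_def)
  let ?d = "pair_det (a p, a q) (a' p, a' q)" and ?w = "det_weight N (a p, a q) (a' p, a' q)"
  have w: "?w > 0" using N by (auto simp: det_weight_def)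
  have "\<exists>i j. i \<noteq> j \<and> real N \<le> ?w * \<bar>real (a i) * real (a' j) - real (a j) * real (a' i)\<bar>"
  proof (cases "?d = 0")
    case True
    then have eq: "a' p = a p" "a' q = a q"
      using pair_det_eq_0_imp_eq[of "(a p, a q)" "(a' p, a' q)"] ab(2) ab'(2) ab(1)[of p] by auto
    obtain k where k: "a k \<noteq> a' k" using ne by (auto simp: fun_eq_iff)
    have "real N * 1 \<le> real (a p) * \<bar>real (a' k) - real (a k)\<bar>"
    proof (rule mult_mono)
      show "real N \<le> real (a p)" using ab(1)[of p] by simp
      show "1 \<le> \<bar>real (a' k) - real (a k)\<bar>" using k by linarith
    qed auto
    also have "\<dots> = \<bar>real (a p) * (real (a' k) - real (a k))\<bar>" by (simp add: abs_mult)
    also have "real (a p) * (real (a' k) - real (a k)) = real (a p) * real (a' k) - real (a k) * real (a' p)"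
      by (simp add: eq algebra_simps)
    finally show ?thesis using True k eq by (intro exI[of _ p] exI[of _ k]) (auto simp: det_weight_def)
  next
    case False
    have "real_of_int ?d = real (a p) * real (a' q) - real (a q) * real (a' p)"
      by (simp add: pair_det_def)
    moreover have "?w * \<bar>real_of_int ?d\<bar> = real N" using False by (simp add: det_weight_def)
    ultimately have "real N \<le> ?w * \<bar>real (a p) * real (a' q) - real (a q) * real (a' p)\<bar>"
      by (simp only: order_refl)
    then show ?thesis using pq by blast
  qed
  then obtain i j where ij: "i \<noteq> j" "real N \<le> ?w * \<bar>real (a i) * real (a' j) - real (a j) * real (a' i)\<bar>"
    by blast
  have "\<eta> * real N \<le> \<eta> * real N'" using N eta by simp
  then have N': "2 \<le> \<eta> * real N'" using N by linarith
  show ?thesis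
    by (rule measure_near_set_Int_le[OF ij(1) ab(1) ab'(1) eta c r d d' N(3,4) N' w ij(2)])
qed

lemma power_divide_self:
  fixes x :: real
  assumes "x \<noteq> 0" "n \<ge> 1"
  shows "x ^ n / x = x ^ (n - 1)"
  using assms by (cases n) auto

text \<open>By \<open>big\<close> the weights of one vector add up to at most r N'^n, which cancels
  the factor 1 / r of the pairwise bound. The constant is thereby free of the cube; its side only
  decides how large N' has to be.\<close>

lemma sum_measure_off_diagonal_le:
  fixes p q :: "'n::finite"
  assumes pq: "p \<noteq> q"
    and eta: "\<eta> > 0" and c: "\<And>k. \<eta> ^ 2 \<le> c $ k" and r: "r > 0"
    and d: "0 \<le> \<delta>" "\<delta> \<le> 1" and d': "0 \<le> \<delta>'" "\<delta>' \<le> 1"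
    and N: "1 \<le> N" "N \<le> N'" "\<eta> * real N \<ge> 2" "2 * \<eta> \<le> real N * r"
    and big: "(15 * real N') ^ (CARD('n) - 2) * (34 * real N' * (1 + ln (256 * real N' ^ 2)) + 1)
      \<le> r * real N' ^ CARD('n)"
  shows "(\<Sum>a\<in>vector_block p q N. \<Sum>a'\<in>vector_block p q N' - {a}.
      measure lborel (near_set a \<delta> \<inter> near_set a' \<delta>' \<inter> cube c r))
    \<le> (4 / \<eta> * 96 ^ CARD('n) * (131072 + 2 * 16 ^ CARD('n) / \<eta>)) * r ^ CARD('n)
      * (real N ^ (CARD('n) - 1) * \<delta>) * (real N' ^ (CARD('n) - 1) * \<delta>')"
proof -
  let ?n = "CARD('n)"
  let ?B = "vector_block p q N" and ?B' = "vector_block p q N'"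
  let ?w = "\<lambda>a a'. det_weight N (a p, a q) (a' p, a' q)"
  define F where "F = (4 / \<eta> * 6 ^ ?n) * r ^ ?n * (\<delta> / real N) * (\<delta>' / real N')"
  have F: "F \<ge> 0" using eta r d d' by (simp add: F_def)
  have n: "?n \<ge> 1" by (simp add: Suc_le_eq)
  have inner: "(\<Sum>a'\<in>?B' - {a}. measure lborel (near_set a \<delta> \<inter> near_set a' \<delta>' \<inter> cube c r))
      \<le> F * ((131072 + 2 * 16 ^ ?n / \<eta>) * real N' ^ ?n)" if a: "a \<in> ?B" for a
  proof -
    have "(\<Sum>a'\<in>?B' - {a}. measure lborel (near_set a \<delta> \<inter> near_set a' \<delta>' \<inter> cube c r))
        \<le> (\<Sum>a'\<in>?B' - {a}. F * (131072 * ?w a a' / r + 2 / \<eta>))"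
      unfolding F_def
      by (intro sum_mono measure_near_set_block_le[OF pq a _ _ eta c r d d' N]) auto
    also have "\<dots> \<le> (\<Sum>a'\<in>?B'. F * (131072 * ?w a a' / r + 2 / \<eta>))"
      using F eta r by (intro sum_mono2 finite_vector_block) (auto simp: det_weight_def)
    also have "\<dots> = F * (131072 / r * (\<Sum>a'\<in>?B'. ?w a a') + real (card ?B') * (2 / \<eta>))"
      by (simp add: sum_distrib_left[symmetric] sum.distrib sum_divide_distrib[symmetric])
    also have "\<dots> \<le> F * (131072 / r * (r * real N' ^ ?n) + (16 ^ ?n * real N' ^ ?n) * (2 / \<eta>))"
      using F eta r sum_vector_block_det_weight_le[OF pq a N(1,2)] big
      by (intro mult_left_mono add_mono mult_right_mono card_vector_block_le) auto
    also have "\<dots> = F * ((131072 + 2 * 16 ^ ?n / \<eta>) * real N' ^ ?n)"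
      using r by (simp add: algebra_simps)
    finally show ?thesis .
  qed
  have "(\<Sum>a\<in>?B. \<Sum>a'\<in>?B' - {a}. measure lborel (near_set a \<delta> \<inter> near_set a' \<delta>' \<inter> cube c r))
      \<le> (\<Sum>a\<in>?B. F * ((131072 + 2 * 16 ^ ?n / \<eta>) * real N' ^ ?n))"
    by (intro sum_mono inner)
  also have "\<dots> = real (card ?B) * (F * ((131072 + 2 * 16 ^ ?n / \<eta>) * real N' ^ ?n))" by simp
  also have "\<dots> \<le> (16 ^ ?n * real N ^ ?n) * (F * ((131072 + 2 * 16 ^ ?n / \<eta>) * real N' ^ ?n))"
    using F eta by (intro mult_right_mono card_vector_block_le) auto
  also have "\<dots> = (4 / \<eta> * (16 ^ ?n * 6 ^ ?n) * (131072 + 2 * 16 ^ ?n / \<eta>)) * r ^ ?n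
      * (real N ^ ?n / real N * \<delta>) * (real N' ^ ?n / real N' * \<delta>')"
    by (simp add: F_def)
  also have "(16 :: real) ^ ?n * 6 ^ ?n = 96 ^ ?n" by (simp flip: power_mult_distrib)
  also have "real N ^ ?n / real N = real N ^ (?n - 1)" using N n by (intro power_divide_self) auto
  also have "real N' ^ ?n / real N' = real N' ^ (?n - 1)" using N n by (intro power_divide_self) auto
  finally show ?thesis .
qed

text \<open>The diagonal terms are linear in \<delta>, whereas the off-diagonal bound is quadratic;
  the former are absorbed once the block weights add up to at least 1.\<close>

lemma sum_measure_diagonal_le:
  fixes p q :: "'n::finite"
  assumes eta: "\<eta> > 0" and c: "\<And>k. \<eta> ^ 2 \<le> c $ k" and r: "r > 0"
    and d: "0 \<le> \<delta>" "\<delta> \<le> 1"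
    and N: "1 \<le> N" "\<eta> * real N \<ge> 2" "2 * \<eta> \<le> real N * r"
  shows "(\<Sum>a\<in>vector_block p q N. measure lborel (near_set a \<delta> \<inter> cube c r))
    \<le> (4 / \<eta> * 32 ^ CARD('n)) * r ^ CARD('n) * (real N ^ (CARD('n) - 1) * \<delta>)"
proof -
  let ?n = "CARD('n)"
  have n: "?n \<ge> 1" by (simp add: Suc_le_eq)
  have "measure lborel (near_set a \<delta> \<inter> cube c r) \<le> 4 * \<delta> / (\<eta> * real N) * (2 * r) ^ ?n"
    if a: "a \<in> vector_block p q N" for a
  proof -
    have aN: "N < a k" for k using a by (auto simp: vector_block_def)
    have "near_set a \<delta> \<inter> cube c r = near_set a \<delta> \<inter> {x. (\<eta> * real N) ^ 2 \<le> square_form a x} \<inter> cube c r"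
      using square_form_ge_on_cube[OF c, of _ r N a p] aN[of p] by auto
    moreover have "measure lborel \<dots> \<le> 4 * \<delta> / (\<eta> * real N) * (2 * r) ^ ?n"
    proof (rule measure_near_set_cube_le[where p = p, OF r d N(2)])
      have "2 * (\<eta> * real N) = (2 * \<eta>) * real N" by simp
      also have "\<dots> \<le> (real N * r) * real N" using N by (intro mult_right_mono) auto
      also have "\<dots> = real N ^ 2 * r" by (simp add: power2_eq_square)
      also have "\<dots> \<le> real (a p) ^ 2 * r" using aN[of p] r by (intro mult_right_mono power_mono) auto
      finally show "2 * (\<eta> * real N) \<le> real (a p) ^ 2 * r" .
    qed
    ultimately show ?thesis by simp
  qed
  then have "(\<Sum>a\<in>vector_block p q N. measure lborel (near_set a \<delta> \<inter> cube c r))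
      \<le> (\<Sum>a\<in>vector_block p q N. 4 * \<delta> / (\<eta> * real N) * (2 * r) ^ ?n)"
    by (rule sum_mono)
  also have "\<dots> = real (card (vector_block p q N)) * (4 * \<delta> / (\<eta> * real N) * (2 * r) ^ ?n)" by simp
  also have "\<dots> \<le> (16 ^ ?n * real N ^ ?n) * (4 * \<delta> / (\<eta> * real N) * (2 * r) ^ ?n)"
    using eta r d by (intro mult_right_mono card_vector_block_le) auto
  also have "\<dots> = (4 / \<eta> * (16 ^ ?n * 2 ^ ?n)) * r ^ ?n * (real N ^ ?n / real N * \<delta>)"
    by (simp add: power_mult_distrib)
  also have "(16 :: real) ^ ?n * 2 ^ ?n = 32 ^ ?n" by (simp flip: power_mult_distrib)
  also have "real N ^ ?n / real N = real N ^ (?n - 1)" using N n by (intro power_divide_self) auto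
  finally show ?thesis .
qed

lemma sum_measure_block_ge:
  fixes p q :: "'n::finite"
  assumes pq: "p \<noteq> q" and c: "\<And>i. 0 \<le> c $ i \<and> c $ i + r \<le> 1" and r: "r > 0"
    and d: "0 \<le> \<delta>" "\<delta> \<le> 1 / 2" and N: "1 \<le> N" "real N * r \<ge> 256 * real CARD('n)"
  shows "r ^ CARD('n) / (32 * real CARD('n) * 2 ^ CARD('n)) * (real N ^ (CARD('n) - 1) * \<delta>)
    \<le> (\<Sum>a\<in>vector_block p q N. measure lborel (near_set a \<delta> \<inter> cube c r))"
proof -
  let ?n = "CARD('n)"
  have n: "?n \<ge> 1" by (simp add: Suc_le_eq)
  have "real N ^ (?n - 1) = real N ^ ?n / real N" using N n by (intro power_divide_self[symmetric]) auto
  then have "r ^ ?n / (32 * real ?n * 2 ^ ?n) * (real N ^ (?n - 1) * \<delta>)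
      = real N ^ ?n * (\<delta> / (32 * real ?n * real N) * (r / 2) ^ ?n)"
    by (simp add: power_divide mult_ac)
  also have "\<dots> \<le> real (card (vector_block p q N)) * (\<delta> / (32 * real ?n * real N) * (r / 2) ^ ?n)"
    using d r by (intro mult_right_mono card_vector_block_ge[OF pq]) auto
  also have "\<dots> = (\<Sum>a\<in>vector_block p q N. \<delta> / (32 * real ?n * real N) * (r / 2) ^ ?n)" by simp
  also have "\<dots> \<le> (\<Sum>a\<in>vector_block p q N. measure lborel (near_set a \<delta> \<inter> cube c r))"
    by (intro sum_mono measure_near_set_cube_ge[OF _ c r d N(2)]) (auto simp: vector_block_def)
  finally show ?thesis .
qed

text \<open>N^(n-1) log N is o(N^n). This provides the hypothesis \<open>big\<close> for every fixed
  cube at sufficiently large scales.\<close>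

lemma eventually_log_term_le:
  fixes r :: real
  assumes r: "r > 0" and n: "n \<ge> 2"
  shows "\<forall>\<^sub>F N :: nat in sequentially.
    (15 * real N) ^ (n - 2) * (34 * real N * (1 + ln (256 * real N ^ 2)) + 1) \<le> r * real N ^ n"
proof -
  have "((\<lambda>x::real. (34 * x * (1 + ln (256 * x ^ 2)) + 1) / x ^ 2) \<longlongrightarrow> 0) at_top"
    by real_asymp
  then have "((\<lambda>N. (34 * real N * (1 + ln (256 * real N ^ 2)) + 1) / real N ^ 2) \<longlongrightarrow> 0) sequentially"
    by (rule filterlim_compose[OF _ filterlim_real_sequentially])
  moreover have "0 < r / 15 ^ (n - 2)" using r by simp
  ultimately have "\<forall>\<^sub>F N in sequentially. (34 * real N * (1 + ln (256 * real N ^ 2)) + 1) / real N ^ 2 < r / 15 ^ (n - 2)"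
    by (rule order_tendstoD(2))
  then show ?thesis
    using eventually_gt_at_top[of 0]
  proof eventually_elim
    case (elim N)
    then have "34 * real N * (1 + ln (256 * real N ^ 2)) + 1 \<le> r / 15 ^ (n - 2) * real N ^ 2"
      by (simp add: pos_divide_less_eq less_imp_le)
    then have "(15 * real N) ^ (n - 2) * (34 * real N * (1 + ln (256 * real N ^ 2)) + 1)
        \<le> (15 * real N) ^ (n - 2) * (r / 15 ^ (n - 2) * real N ^ 2)"
      by (rule mult_left_mono) simp
    also have "\<dots> = r * (real N ^ (n - 2) * real N ^ 2)" by (simp add: power_mult_distrib)
    also have "real N ^ (n - 2) * real N ^ 2 = real N ^ n"
      using n by (simp only: power_add[symmetric] le_add_diff_inverse2)
    finally show ?case .
  qed
qed

text \<open>Condensation with ratio 16. The weight of block k uses \<psi> at its top height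
  16^(k+1), so it is compared with the terms for heights beyond that point, up to 16^(k+2), where
  \<psi> is no larger.\<close>

lemma not_summable_block_weights:
  fixes \<psi> :: "real \<Rightarrow> real"
  assumes pos: "\<And>h. h > 0 \<Longrightarrow> \<psi> h > 0" and anti: "antimono_on {0<..} \<psi>" and n: "n \<ge> 2"
    and div: "\<not> summable (\<lambda>h. real (Suc h) ^ (n - 2) * \<psi> (real (Suc h)))"
  shows "\<not> summable (\<lambda>k. (16 ^ k) ^ (n - 1) * \<psi> (16 ^ Suc k))"
proof
  let ?z = "\<lambda>k. (16 ^ k) ^ (n - 1) * \<psi> (16 ^ Suc k) :: real"
  define f where "f h = real (Suc h) ^ (n - 2) * \<psi> (real (Suc h))" for h
  define C where "C = (16 :: real) ^ (2 * n)"
  assume z: "summable ?z"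
  have f0: "f h \<ge> 0" for h unfolding f_def using pos[of "real (Suc h)"] by (intro mult_nonneg_nonneg) auto
  have z0: "?z k \<ge> 0" for k using pos[of "16 ^ Suc k"] by (intro mult_nonneg_nonneg) auto
  have bd: "(\<Sum>h<16 ^ Suc K. f h) \<le> (\<Sum>h<16. f h) + C * (\<Sum>k<K. ?z k)" for K
  proof (induction K)
    case (Suc K)
    have fh: "f h \<le> (16 ^ (K + 2)) ^ (n - 2) * \<psi> (16 ^ Suc K)"
      if h: "h \<in> {16 ^ Suc K..<16 ^ Suc (Suc K)}" for h
      unfolding f_def
    proof (intro mult_mono power_mono)
      have "Suc h \<le> 16 ^ (K + 2)" using h by simp
      then have "real (Suc h) \<le> real (16 ^ (K + 2))" by (simp only: of_nat_le_iff)
      then show "real (Suc h) \<le> 16 ^ (K + 2)" by simp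
      have "(16 :: nat) ^ Suc K \<le> Suc h" using h by simp
      then have "real (16 ^ Suc K) \<le> real (Suc h)" by (simp only: of_nat_le_iff)
      then have "16 ^ Suc K \<le> real (Suc h)" by simp
      then show "\<psi> (real (Suc h)) \<le> \<psi> (16 ^ Suc K)"
        by (intro monotone_onD[OF anti]) auto
    qed (use pos in \<open>auto intro: less_imp_le\<close>)
    have "(\<Sum>h<16 ^ Suc (Suc K). f h) = (\<Sum>h<16 ^ Suc K. f h) + (\<Sum>h = 16 ^ Suc K..<16 ^ Suc (Suc K). f h)"
      unfolding lessThan_atLeast0 by (intro sum.atLeastLessThan_concat[symmetric]) auto
    also have "(\<Sum>h = 16 ^ Suc K..<16 ^ Suc (Suc K). f h)
        \<le> (\<Sum>h = (16::nat) ^ Suc K..<16 ^ Suc (Suc K). (16 ^ (K + 2)) ^ (n - 2) * \<psi> (16 ^ Suc K))"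
      by (intro sum_mono fh)
    also have "\<dots> = real (16 ^ Suc (Suc K) - 16 ^ Suc K) * ((16 ^ (K + 2)) ^ (n - 2) * \<psi> (16 ^ Suc K))"
      by (simp only: sum_constant card_atLeastLessThan)
    also have "\<dots> \<le> 16 ^ (K + 2) * ((16 ^ (K + 2)) ^ (n - 2) * \<psi> (16 ^ Suc K))"
      using pos[of "16 ^ Suc K"] by (intro mult_right_mono) auto
    also have "\<dots> = (16 ^ (K + 2)) ^ (n - 1) * \<psi> (16 ^ Suc K)"
    proof -
      have "n - 1 = Suc (n - 2)" using n by simp
      then show ?thesis by simp
    qed
    also have "(16 ^ (K + 2) :: real) ^ (n - 1) = (16 ^ 2) ^ (n - 1) * (16 ^ K) ^ (n - 1)"
      by (simp only: power_add power_mult_distrib mult.commute)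
    also have "(16 ^ 2) ^ (n - 1) * (16 ^ K) ^ (n - 1) * \<psi> (16 ^ Suc K) \<le> C * ?z K"
    proof -
      have "((16::real) ^ 2) ^ (n - 1) \<le> C" unfolding C_def power_mult by (rule power_increasing) auto
      then show ?thesis using z0[of K] unfolding mult.assoc by (rule mult_right_mono)
    qed
    finally show ?case using Suc by (simp add: distrib_left)
  qed (simp add: lessThan_Suc)
  have "summable f"
  proof (rule summableI_nonneg_bounded)
    fix m :: nat
    have "m \<le> 16 ^ Suc m"
      using less_exp[of "Suc m"] power_mono[of "2 :: nat" 16 "Suc m"] by linarith
    then have "sum f {..<m} \<le> (\<Sum>h<16 ^ Suc m. f h)" using f0 by (intro sum_mono2) auto
    also have "\<dots> \<le> (\<Sum>h<16. f h) + C * (\<Sum>k<m. ?z k)" by (rule bd)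
    also have "\<dots> \<le> (\<Sum>h<16. f h) + C * suminf ?z"
      using z z0 by (intro add_left_mono mult_left_mono sum_le_suminf) (auto simp: C_def)
    finally show "sum f {..<m} \<le> (\<Sum>h<16. f h) + C * suminf ?z" .
  qed (rule f0)
  then show False using div unfolding f_def[abs_def] by contradiction
qed

lemma ex_sum_ge_of_not_summable:
  fixes z :: "nat \<Rightarrow> real"
  assumes "\<And>k. z k \<ge> 0" "\<not> summable z"
  shows "\<exists>L. B \<le> (\<Sum>k=K..<L. z k)"
proof (rule ccontr)
  assume no: "\<not> ?thesis"
  have "summable z"
  proof (rule summableI_nonneg_bounded)
    fix m
    have "sum z {..<m} \<le> sum z ({..<K} \<union> {K..<m})"
      using assms(1) by (intro sum_mono2) auto
    also have "\<dots> = sum z {..<K} + sum z {K..<m}" by (intro sum.union_disjoint) auto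
    also have "\<dots> \<le> sum z {..<K} + B" using no by (simp add: not_le less_imp_le)
    finally show "sum z {..<m} \<le> sum z {..<K} + B" .
  qed (rule assms(1))
  then show False using assms(2) by simp
qed

lemma vector_block_disjoint:
  assumes "k < l"
  shows "vector_block p q (16 ^ k) \<inter> vector_block p q (16 ^ l) = {}"
proof (rule equals0I)
  fix a assume "a \<in> vector_block p q (16 ^ k) \<inter> vector_block p q (16 ^ l)"
  then have "a p \<le> 16 * 16 ^ k" "16 ^ l < a p" by (auto simp: vector_block_def)
  moreover have "(16 :: nat) ^ Suc k \<le> 16 ^ l" using assms by (intro power_increasing) auto
  ultimately show False by simp
qed

text \<open>If Z is the sum of the block weights over a finite range, the first moment is at least a
  constant times r^n Z and the second is at most C r^n Z^2. Their quotient is \<kappa> r^n, with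
  \<kappa> depending only on n and \<eta>; the cube affects only the scale at which the range
  starts.\<close>

lemma measure_UN_blocks_ge:
  fixes p q :: "'n::finite"
  assumes n2: "CARD('n) \<ge> 2" and pq: "p \<noteq> q"
    and d0: "\<And>k. 0 \<le> \<delta> k" and d: "\<delta> \<longlonglongrightarrow> 0"
    and div: "\<not> summable (\<lambda>k. (16 ^ k) ^ (CARD('n) - 1) * \<delta> k)"
    and eta: "\<eta> > 0"
  defines "C \<equiv> 4 / \<eta> * 96 ^ CARD('n) * (131072 + 2 * 16 ^ CARD('n) / \<eta>) + 4 / \<eta> * 32 ^ CARD('n)"
  defines "\<kappa> \<equiv> (1 / (32 * real CARD('n) * 2 ^ CARD('n))) ^ 2 / C"
  assumes c: "\<And>i. \<eta> ^ 2 \<le> c $ i \<and> c $ i + r \<le> 1" and r: "r > 0"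
  shows "\<kappa> * r ^ CARD('n)
    \<le> measure lborel ((\<Union>k\<in>{K..}. \<Union>a\<in>vector_block p q (16 ^ k). near_set a (\<delta> k)) \<inter> cube c r)"
proof -
  let ?n = "CARD('n)"
  let ?B = "\<lambda>k. vector_block p q (16 ^ k)"
  let ?A = "\<lambda>i. near_set (snd i) (\<delta> (fst i)) \<inter> cube c r"
  define z where "z k = (16 ^ k) ^ (?n - 1) * \<delta> k" for k
  define C1 where "C1 = 4 / \<eta> * 96 ^ ?n * (131072 + 2 * 16 ^ ?n / \<eta>)"
  define C2 where "C2 = 4 / \<eta> * 32 ^ ?n"
  have "131072 + 2 * 16 ^ ?n / \<eta> > 0" using eta by (intro add_pos_pos) auto
  then have C12: "C1 > 0" "C2 > 0" "C = C1 + C2"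
    using eta unfolding C1_def C2_def C_def by (auto intro!: mult_pos_pos divide_pos_pos)
  have z0: "z k \<ge> 0" for k using d0 by (simp add: z_def)
  have c\<eta>: "\<eta> ^ 2 \<le> c $ i" for i using c by blast
  have c01: "0 \<le> c $ i \<and> c $ i + r \<le> 1" for i using c[of i] zero_le_power2[of \<eta>] by linarith
  have pow: "filterlim (\<lambda>k. (16 :: nat) ^ k) sequentially sequentially"
    by (rule filterlim_subseq) (simp add: strict_mono_def)
  have powr: "filterlim (\<lambda>k. real (16 ^ k)) at_top sequentially"
    by (rule filterlim_compose[OF filterlim_real_sequentially pow])
  have "\<forall>\<^sub>F k in sequentially. \<delta> k < 1 / 2"
    using d by (rule order_tendstoD) simp
  moreover have "\<forall>\<^sub>F k in sequentially. real (16 ^ k) \<ge> max (2 / \<eta>) (max (2 * \<eta> / r) (256 * real ?n / r))"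
    using powr by (simp only: filterlim_at_top)
  moreover have "\<forall>\<^sub>F k in sequentially.
      (15 * real (16 ^ k)) ^ (?n - 2) * (34 * real (16 ^ k) * (1 + ln (256 * real (16 ^ k) ^ 2)) + 1)
      \<le> r * real (16 ^ k) ^ ?n"
    using filterlim_iff[THEN iffD1, OF pow, rule_format, OF eventually_log_term_le[OF r n2]] .
  ultimately have "\<forall>\<^sub>F k in sequentially. \<delta> k \<le> 1 / 2 \<and> \<eta> * real (16 ^ k) \<ge> 2 \<and> 2 * \<eta> \<le> real (16 ^ k) * r
      \<and> 256 * real ?n \<le> real (16 ^ k) * r \<and>
      (15 * real (16 ^ k)) ^ (?n - 2) * (34 * real (16 ^ k) * (1 + ln (256 * real (16 ^ k) ^ 2)) + 1)
      \<le> r * real (16 ^ k) ^ ?n"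
  proof eventually_elim
    case (elim k)
    then have "2 / \<eta> \<le> real (16 ^ k)" "2 * \<eta> / r \<le> real (16 ^ k)" "256 * real ?n / r \<le> real (16 ^ k)"
      by simp_all
    then have "2 \<le> real (16 ^ k) * \<eta>" "2 * \<eta> \<le> real (16 ^ k) * r" "256 * real ?n \<le> real (16 ^ k) * r"
      using eta r by (simp_all only: pos_divide_le_eq)
    then show ?case using elim by (simp add: mult.commute)
  qed
  then obtain K0 where K0: "\<And>k. k \<ge> K0 \<Longrightarrow> \<delta> k \<le> 1 / 2" "\<And>k. k \<ge> K0 \<Longrightarrow> \<eta> * real (16 ^ k) \<ge> 2"
      "\<And>k. k \<ge> K0 \<Longrightarrow> 2 * \<eta> \<le> real (16 ^ k) * r" "\<And>k. k \<ge> K0 \<Longrightarrow> 256 * real ?n \<le> real (16 ^ k) * r"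
      "\<And>k. k \<ge> K0 \<Longrightarrow> (15 * real (16 ^ k)) ^ (?n - 2) * (34 * real (16 ^ k) * (1 + ln (256 * real (16 ^ k) ^ 2)) + 1)
      \<le> r * real (16 ^ k) ^ ?n"
    unfolding eventually_sequentially by blast
  have d1: "\<delta> k \<le> 1" if "k \<ge> K0" for k using K0(1)[OF that] by simp
  define K1 where "K1 = max K K0"
  have "\<not> summable z" using div unfolding z_def[abs_def] .
  \<comment> \<open>Divergence enters here: beyond every starting point some finite range has total
    weight at least 1.\<close>
  then obtain L where L: "1 \<le> (\<Sum>k=K1..<L. z k)"
    using ex_sum_ge_of_not_summable[of z 1 K1, OF z0] by blast
  define Z where "Z = (\<Sum>k=K1..<L. z k)"
  have Z: "Z \<ge> 1" using L by (simp add: Z_def)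
  define I where "I = Sigma {K1..<L} ?B"
  have fI: "finite I" unfolding I_def by (intro finite_SigmaI finite_vector_block) auto
  have Afm: "?A i \<in> fmeasurable lborel" for i by (intro fmeasurable_Int_cube borel_near_set)
  define G where "G k l = (\<Sum>a\<in>?B k. \<Sum>b\<in>?B l. measure lborel (near_set a (\<delta> k) \<inter> near_set b (\<delta> l) \<inter> cube c r))" for k l
  have G_sym: "G k l = G l k" for k l
    unfolding G_def by (subst sum.swap) (simp add: Int_commute)
  have G_le: "G k l \<le> C1 * r ^ ?n * z k * z l + (if k = l then C2 * r ^ ?n * z k else 0)"
    if kl: "K0 \<le> k" "k \<le> l" for k l
  proof -
    have kl': "K0 \<le> l" "(16::nat) ^ k \<le> 16 ^ l" using kl by (auto intro: power_increasing)
    have off: "(\<Sum>a\<in>?B k. \<Sum>b\<in>?B l - {a}. measure lborel (near_set a (\<delta> k) \<inter> near_set b (\<delta> l) \<inter> cube c r))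
        \<le> C1 * r ^ ?n * z k * z l"
      using sum_measure_off_diagonal_le[OF pq eta c\<eta> r d0 d1[OF kl(1)] d0 d1[OF kl'(1)] _ kl'(2) K0(2)[OF kl(1)] K0(3)[OF kl(1)] K0(5)[OF kl'(1)]]
      by (simp add: C1_def z_def)
    show ?thesis
    proof (cases "k = l")
      case True
      have "G k l = (\<Sum>a\<in>?B k. measure lborel (near_set a (\<delta> k) \<inter> cube c r)
          + (\<Sum>b\<in>?B l - {a}. measure lborel (near_set a (\<delta> k) \<inter> near_set b (\<delta> l) \<inter> cube c r)))"
        unfolding G_def by (intro sum.cong refl) (simp add: True sum.remove[OF finite_vector_block])
      also have "\<dots> = (\<Sum>a\<in>?B k. measure lborel (near_set a (\<delta> k) \<inter> cube c r))
          + (\<Sum>a\<in>?B k. \<Sum>b\<in>?B l - {a}. measure lborel (near_set a (\<delta> k) \<inter> near_set b (\<delta> l) \<inter> cube c r))"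
        by (rule sum.distrib)
      also have "\<dots> \<le> C2 * r ^ ?n * z k + C1 * r ^ ?n * z k * z l"
        using sum_measure_diagonal_le[OF eta c\<eta> r d0 d1[OF kl(1)] _ K0(2)[OF kl(1)] K0(3)[OF kl(1)], of p q]
        by (intro add_mono off) (simp add: C2_def z_def)
      finally show ?thesis using True by simp
    next
      case False
      then have "k < l" using kl by simp
      then have "?B k \<inter> ?B l = {}" by (rule vector_block_disjoint)
      then have "?B l - {a} = ?B l" if "a \<in> ?B k" for a using that by auto
      then have "G k l = (\<Sum>a\<in>?B k. \<Sum>b\<in>?B l - {a}. measure lborel (near_set a (\<delta> k) \<inter> near_set b (\<delta> l) \<inter> cube c r))"
        unfolding G_def by (intro sum.cong) auto
      then show ?thesis using off False by simp
    qed
  qed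
  \<comment> \<open>The intersection estimates assume the smaller scale first; symmetry of
    \<open>G\<close> removes this restriction.\<close>
  have G_le': "G k l \<le> C1 * r ^ ?n * z k * z l + (if k = l then C2 * r ^ ?n * z k else 0)"
    if "K0 \<le> k" "K0 \<le> l" for k l
  proof (cases "k \<le> l")
    case False
    then show ?thesis using G_le[of l k] that G_sym[of k l] by (simp add: mult.commute mult.left_commute)
  qed (use that G_le in auto)
  define s where "s = (\<Sum>i\<in>I. measure lborel (?A i))"
  define Q where "Q = (\<Sum>i\<in>I. \<Sum>j\<in>I. measure lborel (?A i \<inter> ?A j))"
  define u where "u = measure lborel (\<Union>i\<in>I. ?A i)"
  have s_ge: "r ^ ?n / (32 * real ?n * 2 ^ ?n) * Z \<le> s"
  proof -
    have "r ^ ?n / (32 * real ?n * 2 ^ ?n) * Z = (\<Sum>k=K1..<L. r ^ ?n / (32 * real ?n * 2 ^ ?n) * z k)"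
      by (simp add: Z_def sum_distrib_left)
    also have "\<dots> \<le> (\<Sum>k=K1..<L. \<Sum>a\<in>?B k. measure lborel (near_set a (\<delta> k) \<inter> cube c r))"
    proof (rule sum_mono)
      fix k assume "k \<in> {K1..<L}"
      then have k: "K0 \<le> k" by (simp add: K1_def)
      show "r ^ ?n / (32 * real ?n * 2 ^ ?n) * z k \<le> (\<Sum>a\<in>?B k. measure lborel (near_set a (\<delta> k) \<inter> cube c r))"
        using sum_measure_block_ge[OF pq c01 r d0 K0(1)[OF k] _ K0(4)[OF k]] by (simp add: z_def)
    qed
    also have "\<dots> = s"
      unfolding s_def I_def by (subst sum.Sigma) (auto simp: finite_vector_block case_prod_unfold)
    finally show ?thesis .
  qed
  have "Q = (\<Sum>i\<in>I. \<Sum>l=K1..<L. \<Sum>b\<in>?B l. measure lborel (near_set (snd i) (\<delta> (fst i)) \<inter> near_set b (\<delta> l) \<inter> cube c r))"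
    unfolding Q_def I_def
    by (intro sum.cong refl, subst sum.Sigma)
      (auto simp: finite_vector_block case_prod_unfold Int_ac intro!: sum.cong)
  also have "\<dots> = (\<Sum>k=K1..<L. \<Sum>a\<in>?B k. \<Sum>l=K1..<L. \<Sum>b\<in>?B l. measure lborel (near_set a (\<delta> k) \<inter> near_set b (\<delta> l) \<inter> cube c r))"
    unfolding I_def by (subst sum.Sigma) (auto simp: finite_vector_block case_prod_unfold)
  also have "\<dots> = (\<Sum>k=K1..<L. \<Sum>l=K1..<L. G k l)"
    unfolding G_def by (intro sum.cong refl sum.swap)
  also have "\<dots> \<le> (\<Sum>k=K1..<L. \<Sum>l=K1..<L. C1 * r ^ ?n * z k * z l + (if k = l then C2 * r ^ ?n * z k else 0))"
    by (intro sum_mono G_le') (auto simp: K1_def)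
  also have "\<dots> = (\<Sum>k=K1..<L. C1 * r ^ ?n * z k * Z + C2 * r ^ ?n * z k)"
    by (intro sum.cong refl) (simp add: sum.distrib sum_distrib_left[symmetric] Z_def)
  also have "\<dots> = C1 * r ^ ?n * Z * Z + C2 * r ^ ?n * Z"
    by (simp add: sum.distrib sum_distrib_left[symmetric] sum_distrib_right[symmetric] Z_def)
  \<comment> \<open>Since Z >= 1, the linear diagonal term is bounded by the quadratic one.\<close>
  also have "\<dots> \<le> C1 * r ^ ?n * Z * Z + C2 * r ^ ?n * (Z * Z)"
    using Z C12 r mult_right_mono[OF Z, of Z] by (intro add_left_mono mult_left_mono) auto
  also have "\<dots> = C * r ^ ?n * Z ^ 2" by (simp add: C12 power2_eq_square algebra_simps)
  finally have Q: "Q \<le> C * r ^ ?n * Z ^ 2" .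
  have "(r ^ ?n / (32 * real ?n * 2 ^ ?n) * Z) ^ 2 \<le> s ^ 2"
    using s_ge r Z by (intro power_mono) auto
  also have "s ^ 2 \<le> Q * u"
    unfolding s_def Q_def u_def using fI Afm by (rule measure_UN_ge_second_moment)
  also have "\<dots> \<le> C * r ^ ?n * Z ^ 2 * u"
    using Q by (rule mult_right_mono) (simp add: u_def)
  finally have "(r ^ ?n / (32 * real ?n * 2 ^ ?n) * Z) ^ 2 \<le> C * r ^ ?n * Z ^ 2 * u" .
  moreover have "(r ^ ?n / (32 * real ?n * 2 ^ ?n) * Z) ^ 2 = (C * r ^ ?n * Z ^ 2) * (\<kappa> * r ^ ?n)"
    using C12 by (simp add: \<kappa>_def power_mult_distrib power_divide power2_eq_square)
  moreover have "0 < C * r ^ ?n * Z ^ 2" using C12 r Z by auto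
  ultimately have "\<kappa> * r ^ ?n \<le> u" by (metis mult_le_cancel_left_pos)
  also have "u \<le> measure lborel ((\<Union>k\<in>{K..}. \<Union>a\<in>?B k. near_set a (\<delta> k)) \<inter> cube c r)"
    unfolding u_def
  proof (rule measure_mono_fmeasurable)
    show "(\<Union>i\<in>I. ?A i) \<subseteq> (\<Union>k\<in>{K..}. \<Union>a\<in>?B k. near_set a (\<delta> k)) \<inter> cube c r"
      by (force simp: I_def K1_def)
    show "(\<Union>i\<in>I. ?A i) \<in> sets lborel"
      using fI by (intro sets.finite_UN) (auto intro: borel_near_set borel_cube)
    show "(\<Union>k\<in>{K..}. \<Union>a\<in>?B k. near_set a (\<delta> k)) \<inter> cube c r \<in> fmeasurable lborel"
      by (intro fmeasurable_Int_cube sets.countable_UN' sets.finite_UN finite_vector_block borel_near_set) auto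
  qed
  finally show ?thesis .
qed

text \<open>The tail unions over blocks decrease to a set contained in \<open>W\<close>, because the
  heights in the tail from block K on exceed 16^K. Continuity from above carries the uniform lower
  bound over to the limit.\<close>

lemma measure_W_cube_ge:
  fixes p q :: "'n::finite" and \<psi> :: "real \<Rightarrow> real"
  assumes n2: "CARD('n) \<ge> 2" and pq: "p \<noteq> q"
    and pos: "\<And>h. h > 0 \<Longrightarrow> \<psi> h > 0" and anti: "antimono_on {0<..} \<psi>"
    and lim: "(\<psi> \<longlongrightarrow> 0) at_top"
    and div: "\<not> summable (\<lambda>h. real (Suc h) ^ (CARD('n) - 2) * \<psi> (real (Suc h)))"
    and eta: "\<eta> > 0"
  shows "\<exists>\<kappa>>0. \<forall>(c :: real ^ 'n) r. r > 0 \<longrightarrow> (\<forall>i. \<eta> ^ 2 \<le> c $ i \<and> c $ i + r \<le> 1)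
    \<longrightarrow> \<kappa> * r ^ CARD('n) \<le> measure lborel (W \<psi> \<inter> cube c r)"
proof -
  \<comment> \<open>Heights in block k are at most 16^(k+1), so this tolerance is at most \<psi> at
    the height of each of its vectors.\<close>
  define \<delta> where "\<delta> k = \<psi> (16 ^ Suc k)" for k
  have d0: "0 \<le> \<delta> k" for k using pos[of "16 ^ Suc k"] by (simp add: \<delta>_def)
  have "filterlim (\<lambda>k. (16 :: real) ^ Suc k) at_top sequentially" by real_asymp
  then have d: "\<delta> \<longlonglongrightarrow> 0" unfolding \<delta>_def by (rule filterlim_compose[OF lim])
  have divz: "\<not> summable (\<lambda>k. (16 ^ k) ^ (CARD('n) - 1) * \<delta> k)"
    unfolding \<delta>_def by (rule not_summable_block_weights[OF pos anti n2 div])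
  define C where "C = 4 / \<eta> * 96 ^ CARD('n) * (131072 + 2 * 16 ^ CARD('n) / \<eta>) + 4 / \<eta> * 32 ^ CARD('n)"
  define \<kappa> where "\<kappa> = (1 / (32 * real CARD('n) * 2 ^ CARD('n))) ^ 2 / C"
  have "131072 + 2 * 16 ^ CARD('n) / \<eta> > 0" using eta by (intro add_pos_pos) auto
  then have "C > 0" using eta unfolding C_def by (intro add_pos_pos mult_pos_pos) auto
  then have \<kappa>: "\<kappa> > 0" by (simp add: \<kappa>_def)
  moreover have "\<kappa> * r ^ CARD('n) \<le> measure lborel (W \<psi> \<inter> cube c r)"
    if r: "r > 0" and c: "\<And>i. \<eta> ^ 2 \<le> c $ i \<and> c $ i + r \<le> 1" for c :: "real ^ 'n" and r
  proof -
    define V where "V K = (\<Union>k\<in>{K..}. \<Union>a\<in>vector_block p q (16 ^ k). near_set a (\<delta> k)) \<inter> cube c r" for K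
    have Vfm: "V K \<in> fmeasurable lborel" for K
      unfolding V_def
      by (intro fmeasurable_Int_cube sets.countable_UN' sets.finite_UN finite_vector_block borel_near_set) auto
    have Vge: "\<kappa> * r ^ CARD('n) \<le> measure lborel (V K)" for K
      unfolding V_def \<kappa>_def C_def by (rule measure_UN_blocks_ge[OF n2 pq d0 d divz eta c r])
    have "(\<lambda>K. measure lborel (V K)) \<longlonglongrightarrow> measure lborel (\<Inter>K. V K)"
    proof (rule Lim_measure_decseq)
      show "range V \<subseteq> sets lborel" using fmeasurable_lborelD(1)[OF Vfm] by auto
      show "decseq V" unfolding decseq_def V_def by fastforce
      show "emeasure lborel (V K) \<noteq> \<infinity>" for K using fmeasurable_lborelD(2)[OF Vfm[of K]] by simp
    qed
    then have "\<kappa> * r ^ CARD('n) \<le> measure lborel (\<Inter>K. V K)"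
      by (rule LIMSEQ_le_const) (use Vge in auto)
    also have "\<dots> \<le> measure lborel (W \<psi> \<inter> cube c r)"
    proof (rule measure_mono_fmeasurable)
      show "(\<Inter>K. V K) \<in> sets lborel" using fmeasurable_lborelD(1)[OF Vfm] by (intro sets.countable_INT) auto
      show "W \<psi> \<inter> cube c r \<in> fmeasurable lborel" by (intro fmeasurable_Int_cube borel_W)
      show "(\<Inter>K. V K) \<subseteq> W \<psi> \<inter> cube c r"
      proof
        fix x assume x: "x \<in> (\<Inter>K. V K)"
        then have xc: "x \<in> cube c r" by (auto simp: V_def)
        have "0 \<le> x $ i \<and> x $ i \<le> 1" for i
        proof -
          have "c $ i \<le> x $ i \<and> x $ i \<le> c $ i + r" using xc by (simp add: mem_cube)
          then show ?thesis using c[of i] zero_le_power2[of \<eta>] by linarith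
        qed
        then have x01: "x \<in> cbox 0 1" by (simp add: mem_box_cart)
        let ?S = "{(a :: 'n \<Rightarrow> nat, b :: nat). a \<noteq> (\<lambda>_. 0) \<and>
          \<bar>(\<Sum>i\<in>UNIV. real (a i) ^ 2 * x $ i) - real b ^ 2\<bar> < \<psi> (real (height a))}"
        have unb: "\<exists>a b. (a, b) \<in> ?S \<and> height a > 16 ^ K" for K
        proof -
          have "x \<in> V K" using x by auto
          then obtain k a where ka: "k \<ge> K" "a \<in> vector_block p q (16 ^ k)" "x \<in> near_set a (\<delta> k)"
            by (auto simp: V_def)
          then obtain b :: nat where b: "\<bar>square_form a x - real b ^ 2\<bar> < \<delta> k"
            by (auto simp: near_set_def near_square_def)
          have ab: "16 ^ k < a i" "a i \<le> 16 * 16 ^ k" for i using ka by (auto simp: vector_block_def)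
          have h_le: "height a \<le> 16 ^ Suc k" unfolding height_def using ab(2) by (subst Max_le_iff) auto
          have h_gt: "16 ^ k < height a" unfolding height_def using ab(1)[of p] by (subst Max_gr_iff) auto
          have "real (height a) \<le> real (16 ^ Suc k)" using h_le by (simp only: of_nat_le_iff)
          moreover have "0 < real (height a)" using h_gt by simp
          ultimately have "\<delta> k \<le> \<psi> (real (height a))"
            unfolding \<delta>_def by (intro monotone_onD[OF anti]) auto
          then have "\<bar>square_form a x - real b ^ 2\<bar> < \<psi> (real (height a))" using b by linarith
          moreover have "a \<noteq> (\<lambda>_. 0)" using ab(1)[of p] by auto
          ultimately have "(a, b) \<in> ?S" by (simp add: square_form_def)
          moreover have "(16 :: nat) ^ K \<le> 16 ^ k" using ka(1) by (rule power_increasing) simp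
          with h_gt have "16 ^ K < height a" by (rule le_less_trans[rotated])
          ultimately show ?thesis by blast
        qed
        have "infinite ?S"
        proof
          assume fin: "finite ?S"
          define H where "H = Max ((\<lambda>s. height (fst s)) ` ?S)"
          obtain a b where ab: "(a, b) \<in> ?S" "height a > 16 ^ H" using unb[of H] by blast
          have "height a \<le> H" unfolding H_def using fin ab(1) by (intro Max_ge finite_imageI) force+
          moreover have "H < 2 ^ H" by (rule less_exp)
          moreover have "(2 :: nat) ^ H \<le> 16 ^ H" by (rule power_mono) auto
          ultimately show False using ab by linarith
        qed
        then show "x \<in> W \<psi> \<inter> cube c r" using x01 xc by (simp add: W_def)
      qed
    qed
    finally show ?thesis .
  qed
  ultimately show ?thesis by blast
qed

text \<open>The density \<kappa> depends on the lower bound for the coordinates, so full measure is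
  first obtained above each fixed \<alpha> = \<eta>^2. Countably many \<alpha> then exhaust the open
  unit cube, and its boundary is null.\<close>

lemma emeasure_cbox_Diff_W_eq_0:
  fixes \<psi> :: "real \<Rightarrow> real"
  assumes n2: "CARD('n::finite) \<ge> 2"
    and pos: "\<And>h. h > 0 \<Longrightarrow> \<psi> h > 0" and anti: "antimono_on {0<..} \<psi>"
    and lim: "(\<psi> \<longlongrightarrow> 0) at_top"
    and div: "\<not> summable (\<lambda>h. real (Suc h) ^ (CARD('n) - 2) * \<psi> (real (Suc h)))"
  shows "emeasure lborel (cbox 0 1 - (W \<psi> :: (real ^ 'n) set)) = 0"
proof -
  have "\<not> CARD('n) \<le> Suc 0" using n2 by simp
  then obtain p q :: 'n where pq: "p \<noteq> q" by (auto simp: card_le_Suc0_iff_eq)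
  let ?W = "W \<psi> :: (real ^ 'n) set"
  have inner: "cbox (\<chi> i. \<alpha>) (\<chi> i. 1) - ?W \<in> null_sets lborel" if \<alpha>: "0 < \<alpha>" "\<alpha> < 1" for \<alpha>
  proof -
    have s: "sqrt \<alpha> > 0" "sqrt \<alpha> ^ 2 = \<alpha>" using \<alpha> by auto
    obtain \<kappa> where \<kappa>: "\<kappa> > 0" "\<And>(c :: real ^ 'n) r. r > 0 \<Longrightarrow> (\<And>i. \<alpha> \<le> c $ i \<and> c $ i + r \<le> 1)
        \<Longrightarrow> \<kappa> * r ^ CARD('n) \<le> measure lborel (?W \<inter> cube c r)"
      using measure_W_cube_ge[OF n2 pq pos anti lim div s(1)] unfolding s(2) by blast
    \<comment> \<open>Capping \<kappa> at 1 meets the requirement \<kappa> <= 1 of the covering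
      argument.\<close>
    have "emeasure lborel (cbox (\<chi> i. \<alpha>) (\<chi> i. 1) - ?W) = 0"
    proof (rule emeasure_Diff_eq_0_of_cubes[where \<kappa> = "min \<kappa> 1", OF borel_W])
      fix c :: "real ^ 'n" and r :: real assume r: "r > 0" and c: "\<And>i. \<alpha> \<le> c $ i \<and> c $ i + r \<le> 1"
      have "min \<kappa> 1 * r ^ CARD('n) \<le> \<kappa> * r ^ CARD('n)" using r by (intro mult_right_mono) auto
      also have "\<dots> \<le> measure lborel (?W \<inter> cube c r)" by (rule \<kappa>(2)[OF r c])
      finally show "min \<kappa> 1 * r ^ CARD('n) \<le> measure lborel (?W \<inter> cube c r)" .
    qed (use \<kappa> \<alpha> in auto)
    then show ?thesis using borel_W[of \<psi>] by (intro null_setsI) auto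
  qed
  have "cbox 0 1 - ?W \<in> null_sets lborel"
  proof (rule null_sets_subset)
    have "cbox 0 1 - box 0 1 \<in> null_sets (lborel :: (real ^ 'n) measure)"
      using negligible_frontier_interval[of 0 "1 :: real ^ 'n"]
      by (simp add: negligible_iff_null_sets null_sets_completion_iff)
    \<comment> \<open>The shift by 2 keeps every lower bound strictly between 0 and 1.\<close>
    moreover have "(\<Union>m. cbox (\<chi> i. 1 / real (m + 2)) (\<chi> i. 1) - ?W) \<in> null_sets lborel"
      by (intro null_sets_UN inner) auto
    ultimately show "(cbox 0 1 - box 0 1) \<union> (\<Union>m. cbox (\<chi> i. 1 / real (m + 2)) (\<chi> i. 1) - ?W) \<in> null_sets lborel"
      by (rule null_sets.Un)
    show "cbox 0 1 - ?W \<in> sets lborel" using borel_W[of \<psi>] by auto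
    show "cbox 0 1 - ?W \<subseteq> (cbox 0 1 - box 0 1) \<union> (\<Union>m. cbox (\<chi> i. 1 / real (m + 2)) (\<chi> i. 1) - ?W)"
    proof
      fix x assume x: "x \<in> cbox 0 1 - ?W"
      show "x \<in> (cbox 0 1 - box 0 1) \<union> (\<Union>m. cbox (\<chi> i. 1 / real (m + 2)) (\<chi> i. 1) - ?W)"
      proof (cases "x \<in> box 0 1")
        case True
        define e where "e = Min (range (\<lambda>i. x $ i))"
        have e: "e > 0" unfolding e_def using True by (subst Min_gr_iff) (auto simp: mem_box_cart)
        have e_le: "e \<le> x $ i" for i unfolding e_def by (intro Min_le) auto
        obtain m :: nat where m: "1 / e < real m" using reals_Archimedean2 by blast
        then have "1 < real m * e" using e by (simp add: pos_divide_less_eq)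
        also have "\<dots> \<le> real (m + 2) * e" using e by (intro mult_right_mono) auto
        finally have "1 / real (m + 2) \<le> e" by (simp add: pos_divide_le_eq mult.commute)
        then have "1 / real (m + 2) \<le> x $ i" for i using e_le[of i] by linarith
        then have "x \<in> cbox (\<chi> i. 1 / real (m + 2)) (\<chi> i. 1)" using x by (simp add: mem_box_cart)
        then show ?thesis using x by blast
      qed (use x in auto)
    qed
  qed
  then show ?thesis by (rule null_setsD1)
qed

theorem theorem1:
  fixes \<psi> :: "real \<Rightarrow> real"
  assumes n2: "CARD('n::finite) \<ge> 2"
    and pos: "\<And>h. h > 0 \<Longrightarrow> \<psi> h > 0"
    and mon: "mono_on {0<..} \<psi> \<or> antimono_on {0<..} \<psi>"
    and lim: "(\<psi> \<longlongrightarrow> 0) at_top"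
  shows "(W \<psi> :: (real ^ 'n) set) \<in> sets lebesgue \<and>
    (summable (\<lambda>h. real (Suc h) ^ (CARD('n) - 2) * \<psi> (real (Suc h)))
       \<longrightarrow> measure lebesgue (W \<psi> :: (real ^ 'n) set) = 0) \<and>
    (\<not> summable (\<lambda>h. real (Suc h) ^ (CARD('n) - 2) * \<psi> (real (Suc h)))
       \<longrightarrow> measure lebesgue (W \<psi> :: (real ^ 'n) set) = 1)"
proof (intro conjI impI)
  let ?W = "W \<psi> :: (real ^ 'n) set"
  have Wb: "?W \<in> sets lborel" using borel_W[of \<psi>] by simp
  then show "?W \<in> sets lebesgue" by (rule sets_completionI_sets)
  {
    assume conv: "summable (\<lambda>h. real (Suc h) ^ (CARD('n) - 2) * \<psi> (real (Suc h)))"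
    have "emeasure lborel ?W = 0" by (rule emeasure_W_eq_0[OF n2 pos lim conv])
    then show "measure lebesgue ?W = 0" using Wb by (simp add: measure_def)
  }
  assume div: "\<not> summable (\<lambda>h. real (Suc h) ^ (CARD('n) - 2) * \<psi> (real (Suc h)))"
  \<comment> \<open>An increasing \<psi> stays above the positive number \<psi>(1) from 1 on and
    cannot tend to 0, so only the decreasing case remains.\<close>
  have "\<not> mono_on {0<..} \<psi>"
  proof
    assume mono: "mono_on {0<..} \<psi>"
    have "\<forall>\<^sub>F x in at_top. \<psi> 1 \<le> \<psi> x"
      using eventually_ge_at_top[of 1] by eventually_elim (auto intro!: monotone_onD[OF mono])
    then have "\<psi> 1 \<le> 0" by (rule tendsto_lowerbound[OF lim]) simp
    then show False using pos[of 1] by simp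
  qed
  then have anti: "antimono_on {0<..} \<psi>" using mon by blast
  have "emeasure lborel (cbox 0 1 - ?W) = 0"
    by (rule emeasure_cbox_Diff_W_eq_0[OF n2 pos anti lim div])
  then have null: "cbox 0 1 - ?W \<in> null_sets lborel" using Wb by (intro null_setsI) auto
  have "?W \<subseteq> cbox 0 1" by (auto simp: W_def)
  then have "measure lborel ?W = measure lborel (?W \<union> (cbox 0 1 - ?W))"
    using Wb null by (intro measure_Un_null_set[symmetric])
  also have "?W \<union> (cbox 0 1 - ?W) = cube 0 1"
    using \<open>?W \<subseteq> cbox 0 1\<close> by (auto simp: cube_def one_vec_def)
  also have "measure lborel (cube 0 1 :: (real ^ 'n) set) = 1" by (simp add: measure_cube)
  finally show "measure lebesgue ?W = 1" using Wb by simp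
qed

end
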